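(* The space $Y=Ti(2;1/2)$ is not minimal.
   Context: Definition of $Y=Ti(2;1/2)$: let $c_{00}$ be the space of finitely supported real sequences. For $x\in c_{00}$ and $E\subseteq\mathbb{N}$ let $Ex(i)=x(i)$ if $i\in E$ and $Ex(i)=0$ otherwise; $E<F$ means $\max E<\min F$. $Y$ is the completion of $c_{00}$ under the norm given by the implicit equation $$\|x\|=\max\Big(\|x\|_\infty,\ \sup\frac1{2\sqrt n}\sum_{i=1}^n\|E_ix\|\Big),$$ where the sup is taken over all $n\in\mathbb{N}$ and all subsets $E_1<\cdots<E_n$ of $\mathbb{N}$. An (infinite dimensional) Banach space $X$ is minimal if every (closed, infinite dimensional) subspace of $X$ contains a further subspace isomorphic to $X$. *)

theory Defs
  imports "HOL-Analysis.Analysis"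
begin

section \<open>The completion of a normed space\<close>

definition completion_rel :: "(nat \<Rightarrow> 'a::real_normed_vector) \<Rightarrow> (nat \<Rightarrow> 'a) \<Rightarrow> bool" where
  "completion_rel X Y \<longleftrightarrow> Cauchy X \<and> Cauchy Y \<and> (\<lambda>n. X n - Y n) \<longlonglongrightarrow> 0"

lemma completion_rel_part_equivp: "part_equivp completion_rel"
proof (rule part_equivpI)
  show "\<exists>x::nat \<Rightarrow> 'a. completion_rel x x"
    by (rule exI[of _ "\<lambda>_. 0"]) (simp add: completion_rel_def Cauchy_def)
  show "symp (completion_rel :: (nat \<Rightarrow> 'a) \<Rightarrow> _)"
  proof (rule sympI)
    fix X Y :: "nat \<Rightarrow> 'a"
    assume "completion_rel X Y"
    moreover from this have "(\<lambda>n. - (X n - Y n)) \<longlonglongrightarrow> - 0"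
      unfolding completion_rel_def by (intro tendsto_minus) auto
    ultimately show "completion_rel Y X" by (simp add: completion_rel_def)
  qed
  show "transp (completion_rel :: (nat \<Rightarrow> 'a) \<Rightarrow> _)"
  proof (rule transpI)
    fix X Y Z :: "nat \<Rightarrow> 'a"
    assume a: "completion_rel X Y" "completion_rel Y Z"
    then have "(\<lambda>n. (X n - Y n) + (Y n - Z n)) \<longlonglongrightarrow> 0 + 0"
      unfolding completion_rel_def by (intro tendsto_add) auto
    with a show "completion_rel X Z" by (simp add: completion_rel_def)
  qed
qed

quotient_type (overloaded) 'a banach_completion =
  "nat \<Rightarrow> 'a::real_normed_vector" / partial: completion_rel
  by (rule completion_rel_part_equivp)

lemma Cauchy_scaleR_const:
  fixes X :: "nat \<Rightarrow> 'a::real_normed_vector"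
  assumes "Cauchy X" shows "Cauchy (\<lambda>n. c *\<^sub>R X n)"
  using bounded_linear.Cauchy[OF bounded_linear_scaleR_right assms] .

lemma Cauchy_plus:
  fixes X Y :: "nat \<Rightarrow> 'a::real_normed_vector"
  assumes X: "Cauchy X" and Y: "Cauchy Y" shows "Cauchy (\<lambda>n. X n + Y n)"
proof (rule metric_CauchyI)
  fix e :: real assume "e > 0"
  then obtain M N where
    M: "\<And>m n. m \<ge> M \<Longrightarrow> n \<ge> M \<Longrightarrow> dist (X m) (X n) < e / 2" and
    N: "\<And>m n. m \<ge> N \<Longrightarrow> n \<ge> N \<Longrightarrow> dist (Y m) (Y n) < e / 2"
    using X Y unfolding Cauchy_def by (meson half_gt_zero)
  have "dist (X m + Y m) (X n + Y n) < e" if "m \<ge> max M N" "n \<ge> max M N" for m n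
    using M[of m n] N[of m n] that dist_triangle_add[of "X m" "Y m" "X n" "Y n"] by simp
  then show "\<exists>M. \<forall>m\<ge>M. \<forall>n\<ge>M. dist (X m + Y m) (X n + Y n) < e" by blast
qed

lemma completion_rel_add:
  assumes "completion_rel X X'" "completion_rel Y Y'"
  shows "completion_rel (\<lambda>n. X n + Y n) (\<lambda>n. X' n + Y' n)"
proof -
  have "(\<lambda>n. (X n - X' n) + (Y n - Y' n)) \<longlonglongrightarrow> 0 + 0"
    using assms unfolding completion_rel_def by (intro tendsto_add) simp_all
  moreover have "(\<lambda>n. (X n - X' n) + (Y n - Y' n)) = (\<lambda>n. (X n + Y n) - (X' n + Y' n))"
    by (simp add: algebra_simps)
  ultimately show ?thesis
    using assms unfolding completion_rel_def by (simp add: Cauchy_plus)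
qed

lemma completion_rel_scaleR:
  assumes "completion_rel X X'"
  shows "completion_rel (\<lambda>n. c *\<^sub>R X n) (\<lambda>n. c *\<^sub>R X' n)"
proof -
  have "(\<lambda>n. c *\<^sub>R (X n - X' n)) \<longlonglongrightarrow> c *\<^sub>R 0"
    using assms unfolding completion_rel_def by (intro tendsto_scaleR) auto
  with assms show ?thesis
    by (auto simp: completion_rel_def Cauchy_scaleR_const scaleR_diff_right)
qed

lemma Cauchy_norm_lim:
  fixes X :: "nat \<Rightarrow> 'a::real_normed_vector"
  assumes "Cauchy X" shows "(\<lambda>n. norm (X n)) \<longlonglongrightarrow> lim (\<lambda>n. norm (X n))"
proof -
  have "Cauchy (\<lambda>n. norm (X n))"
  proof (rule metric_CauchyI)
    fix e :: real assume "e > 0"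
    then obtain M where M: "\<And>m n. m \<ge> M \<Longrightarrow> n \<ge> M \<Longrightarrow> dist (X m) (X n) < e"
      using assms unfolding Cauchy_def by blast
    have "dist (norm (X m)) (norm (X n)) \<le> dist (X m) (X n)" for m n
      by (simp add: dist_norm dist_real_def norm_triangle_ineq3)
    with M show "\<exists>M. \<forall>m\<ge>M. \<forall>n\<ge>M. dist (norm (X m)) (norm (X n)) < e"
      by (meson order_le_less_trans)
  qed
  then show ?thesis by (simp add: Cauchy_convergent_iff convergent_LIMSEQ_iff)
qed

lemma completion_rel_norm:
  fixes X Y :: "nat \<Rightarrow> 'a::real_normed_vector"
  assumes "completion_rel X Y"
  shows "lim (\<lambda>n. norm (X n)) = lim (\<lambda>n. norm (Y n))"
proof -
  have X: "(\<lambda>n. norm (X n)) \<longlonglongrightarrow> lim (\<lambda>n. norm (X n))"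
    and Y: "(\<lambda>n. norm (Y n)) \<longlonglongrightarrow> lim (\<lambda>n. norm (Y n))"
    using assms Cauchy_norm_lim by (auto simp: completion_rel_def)
  have "(\<lambda>n. norm (X n - Y n)) \<longlonglongrightarrow> 0"
    using assms tendsto_norm_zero by (auto simp: completion_rel_def)
  then have "(\<lambda>n. norm (X n) - norm (Y n)) \<longlonglongrightarrow> 0"
    by (rule Lim_null_comparison[rotated]) (simp add: norm_triangle_ineq3)
  with tendsto_diff[OF X Y] have "lim (\<lambda>n. norm (X n)) - lim (\<lambda>n. norm (Y n)) = 0"
    using LIMSEQ_unique by blast
  then show ?thesis by simp
qed

instantiation banach_completion :: (real_normed_vector) real_normed_vector
begin

lift_definition zero_banach_completion :: "'a banach_completion" is "\<lambda>_. 0"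
  by (simp add: completion_rel_def Cauchy_def)

lift_definition plus_banach_completion ::
  "'a banach_completion \<Rightarrow> 'a banach_completion \<Rightarrow> 'a banach_completion" is "\<lambda>X Y n. X n + Y n"
  by (rule completion_rel_add)

lift_definition scaleR_banach_completion ::
  "real \<Rightarrow> 'a banach_completion \<Rightarrow> 'a banach_completion" is "\<lambda>c X n. c *\<^sub>R X n"
  by (rule completion_rel_scaleR)

lift_definition uminus_banach_completion ::
  "'a banach_completion \<Rightarrow> 'a banach_completion" is "\<lambda>X n. - X n"
  using completion_rel_scaleR[where c = "-1"] by simp

lift_definition minus_banach_completion ::
  "'a banach_completion \<Rightarrow> 'a banach_completion \<Rightarrow> 'a banach_completion" is "\<lambda>X Y n. X n - Y n"
  subgoal for X X' Y Y'
    using completion_rel_add[of X X' "\<lambda>n. - Y n" "\<lambda>n. - Y' n"]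
      completion_rel_scaleR[of Y Y' "-1"] by simp
  done

lift_definition norm_banach_completion :: "'a banach_completion \<Rightarrow> real"
  is "\<lambda>X. lim (\<lambda>n. norm (X n))"
  by (rule completion_rel_norm)

definition dist_banach_completion :: "'a banach_completion \<Rightarrow> 'a banach_completion \<Rightarrow> real" where
  "dist_banach_completion x y = norm (x - y)"

definition sgn_banach_completion :: "'a banach_completion \<Rightarrow> 'a banach_completion" where
  "sgn_banach_completion x = inverse (norm x) *\<^sub>R x"

definition uniformity_banach_completion ::
  "('a banach_completion \<times> 'a banach_completion) filter" where
  "uniformity_banach_completion = (INF e\<in>{0<..}. principal {(x, y). dist x y < e})"

definition open_banach_completion :: "'a banach_completion set \<Rightarrow> bool" where
  "open_banach_completion U \<longleftrightarrow>
    (\<forall>x\<in>U. eventually (\<lambda>(x', y). x' = x \<longrightarrow> y \<in> U) uniformity)"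

instance
proof
  fix x y z :: "'a banach_completion" and a b :: real
  have rel: "completion_rel X Y"
    if "Cauchy X" "\<And>n. X n = Y n" for X Y :: "nat \<Rightarrow> 'a"
  proof -
    have "X = Y" using that by auto
    with that show ?thesis by (simp add: completion_rel_def)
  qed
  show "x + y + z = x + (y + z)"
    by transfer (auto intro!: rel Cauchy_plus simp: completion_rel_def add.assoc)
  show "x + y = y + x"
    by transfer (auto intro!: rel Cauchy_plus simp: completion_rel_def add.commute)
  show "0 + x = x"
    by transfer (auto intro!: rel simp: completion_rel_def)
  show "- x + x = 0"
    by transfer (auto intro!: rel simp: completion_rel_def Cauchy_def)
  show "x - y = x + - y"
    by transfer (use Cauchy_plus[OF _ Cauchy_scaleR_const[where c = "-1"]] in
      \<open>auto intro!: rel simp: completion_rel_def\<close>)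
  show "a *\<^sub>R (x + y) = a *\<^sub>R x + a *\<^sub>R y"
    by transfer (auto intro!: rel Cauchy_plus Cauchy_scaleR_const
      simp: completion_rel_def scaleR_add_right)
  show "(a + b) *\<^sub>R x = a *\<^sub>R x + b *\<^sub>R x"
    by transfer (auto intro!: rel Cauchy_plus Cauchy_scaleR_const
      simp: completion_rel_def scaleR_add_left)
  show "a *\<^sub>R b *\<^sub>R x = (a * b) *\<^sub>R x"
    by transfer (auto intro!: rel Cauchy_scaleR_const simp: completion_rel_def)
  show "1 *\<^sub>R x = x"
    by transfer (auto intro!: rel simp: completion_rel_def)
  show "dist x y = norm (x - y)" by (rule dist_banach_completion_def)
  show "sgn x = inverse (norm x) *\<^sub>R x" by (rule sgn_banach_completion_def)
  show "(uniformity :: ('a banach_completion \<times> 'a banach_completion) filter)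
      = (INF e\<in>{0<..}. principal {(x, y). dist x y < e})"
    by (rule uniformity_banach_completion_def)
  show "open U \<longleftrightarrow> (\<forall>x\<in>U. \<forall>\<^sub>F (x', y) in uniformity. x' = x \<longrightarrow> y \<in> U)"
    for U :: "'a banach_completion set"
    by (rule open_banach_completion_def)
  show "norm x = 0 \<longleftrightarrow> x = 0"
  proof transfer
    fix X :: "nat \<Rightarrow> 'a" assume "completion_rel X X"
    then have C: "Cauchy X" by (simp add: completion_rel_def)
    show "(lim (\<lambda>n. norm (X n)) = 0) = completion_rel X (\<lambda>_. 0)"
    proof
      assume "lim (\<lambda>n. norm (X n)) = 0"
      with Cauchy_norm_lim[OF C] have "X \<longlonglongrightarrow> 0" by (simp add: tendsto_norm_zero_iff)
      with C show "completion_rel X (\<lambda>_. 0)" by (simp add: completion_rel_def Cauchy_def)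
    next
      assume "completion_rel X (\<lambda>_. 0)"
      from completion_rel_norm[OF this] show "lim (\<lambda>n. norm (X n)) = 0" by simp
    qed
  qed
  show "norm (x + y) \<le> norm x + norm y"
  proof transfer
    fix X Y :: "nat \<Rightarrow> 'a"
    assume "completion_rel X X" "completion_rel Y Y"
    then have C: "Cauchy X" "Cauchy Y" by (auto simp: completion_rel_def)
    show "lim (\<lambda>n. norm (X n + Y n)) \<le> lim (\<lambda>n. norm (X n)) + lim (\<lambda>n. norm (Y n))"
      by (rule LIMSEQ_le[OF Cauchy_norm_lim[OF Cauchy_plus[OF C]]
            tendsto_add[OF Cauchy_norm_lim[OF C(1)] Cauchy_norm_lim[OF C(2)]]])
        (auto intro: norm_triangle_ineq)
  qed
  show "norm (a *\<^sub>R x) = \<bar>a\<bar> * norm x"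
  proof transfer
    fix a and X :: "nat \<Rightarrow> 'a" assume "completion_rel X X"
    then have C: "Cauchy X" by (auto simp: completion_rel_def)
    have "(\<lambda>n. norm (a *\<^sub>R X n)) \<longlonglongrightarrow> \<bar>a\<bar> * lim (\<lambda>n. norm (X n))"
      using tendsto_mult_left[OF Cauchy_norm_lim[OF C], of "\<bar>a\<bar>"] by simp
    then show "lim (\<lambda>n. norm (a *\<^sub>R X n)) = \<bar>a\<bar> * lim (\<lambda>n. norm (X n))" by (rule limI)
  qed
qed

end

lift_definition completion_embed :: "'a::real_normed_vector \<Rightarrow> 'a banach_completion"
  is "\<lambda>a _. a"
  by (simp add: completion_rel_def Cauchy_def)

lemma norm_completion_embed [simp]: "norm (completion_embed a) = norm a"
  by transfer simp

lemma linear_completion_embed: "linear completion_embed"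
  by (rule linearI; transfer) (simp_all add: completion_rel_def Cauchy_def)

lemma completion_embed_diff: "completion_embed (a - b) = completion_embed a - completion_embed b"
  using linear_diff[OF linear_completion_embed] .

lemma completion_embed_tendsto:
  assumes "completion_rel X X"
  shows "(\<lambda>n. completion_embed (X n)) \<longlonglongrightarrow> abs_banach_completion X"
proof (rule metric_LIMSEQ_I)
  fix e :: real assume "e > 0"
  from assms have C: "Cauchy X" by (simp add: completion_rel_def)
  then obtain M where M: "\<And>m n. m \<ge> M \<Longrightarrow> n \<ge> M \<Longrightarrow> dist (X m) (X n) < e / 2"
    using \<open>e > 0\<close> unfolding Cauchy_def by (meson half_gt_zero)
  have "dist (completion_embed (X m)) (abs_banach_completion X) < e" if "m \<ge> M" for m
  proof -
    have Cm: "Cauchy (\<lambda>n. X m - X n)"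
      using Cauchy_plus[OF _ Cauchy_scaleR_const[OF C, of "-1"], of "\<lambda>_. X m"]
      by (simp add: Cauchy_def)
    have rc: "completion_rel (\<lambda>_. X m) (\<lambda>_. X m)" by (simp add: completion_rel_def Cauchy_def)
    have rd: "completion_rel (\<lambda>n. X m - X n) (\<lambda>n. X m - X n)"
      using Cm by (simp add: completion_rel_def)
    have "dist (completion_embed (X m)) (abs_banach_completion X) = lim (\<lambda>n. norm (X m - X n))"
      unfolding dist_norm completion_embed.abs_eq
      by (simp add: minus_banach_completion.abs_eq[OF rc assms] norm_banach_completion.abs_eq[OF rd])
    also have "\<dots> \<le> e / 2"
    proof (rule LIMSEQ_le_const2[OF Cauchy_norm_lim[OF Cm]])
      show "\<exists>N. \<forall>n\<ge>N. norm (X m - X n) \<le> e / 2"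
        using M[OF that] by (intro exI[of _ M]) (auto simp: dist_norm less_imp_le)
    qed
    finally show ?thesis using \<open>e > 0\<close> by simp
  qed
  then show "\<exists>no. \<forall>n\<ge>no. dist (completion_embed (X n)) (abs_banach_completion X) < e" by blast
qed

lemma abs_banach_completion_cases:
  obtains X where "completion_rel X X" "y = abs_banach_completion X"
proof -
  have "\<exists>X. completion_rel X X \<and> y = abs_banach_completion X"
    using Quotient_banach_completion unfolding Quotient_def by metis
  then show thesis using that by blast
qed

lemma completion_embed_dense: "closure (range completion_embed) = UNIV"
proof -
  have "y \<in> closure (range completion_embed)" for y :: "'a banach_completion"
  proof -
    obtain X where X: "completion_rel X X" "y = abs_banach_completion X"
      by (rule abs_banach_completion_cases)
    show ?thesis
      unfolding closure_sequential using completion_embed_tendsto[OF X(1)] X(2)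
      by (intro exI[of _ "\<lambda>n. completion_embed (X n)"]) auto
  qed
  then show ?thesis by auto
qed

instance banach_completion :: (real_normed_vector) banach
proof
  fix f :: "nat \<Rightarrow> 'a banach_completion" assume f: "Cauchy f"
  have "\<exists>a. dist (completion_embed a) (f n) < inverse (real (Suc n))" for n
  proof -
    have "f n \<in> closure (range completion_embed)" by (simp add: completion_embed_dense)
    then show ?thesis
      unfolding closure_approachable using positive_imp_inverse_positive[of "real (Suc n)"] by auto
  qed
  then obtain a where a: "\<And>n. dist (completion_embed (a n)) (f n) < inverse (real (Suc n))"
    by metis
  have null: "(\<lambda>n. completion_embed (a n) - f n) \<longlonglongrightarrow> 0"
    by (rule Lim_null_comparison[OF _ LIMSEQ_inverse_real_of_nat])
      (use a in \<open>auto simp: dist_norm less_imp_le\<close>)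
  have "Cauchy (\<lambda>n. (completion_embed (a n) - f n) + f n)"
    using LIMSEQ_imp_Cauchy[OF null] f by (rule Cauchy_plus)
  then have "Cauchy (\<lambda>n. completion_embed (a n))" by simp
  then have "Cauchy a"
    unfolding Cauchy_def dist_norm completion_embed_diff[symmetric] norm_completion_embed .
  then have "completion_rel a a" by (simp add: completion_rel_def)
  from tendsto_diff[OF completion_embed_tendsto[OF this] null] have "f \<longlonglongrightarrow> abs_banach_completion a"
    by simp
  then show "convergent f" by (auto simp: convergent_def)
qed

section \<open>Minimal Banach spaces\<close>

definition infinite_dimensional :: "'a::real_vector set \<Rightarrow> bool" where
  "infinite_dimensional V \<longleftrightarrow> \<not> (\<exists>B. finite B \<and> V \<subseteq> span B)"

text \<open>
  For subspaces, a linear map \<open>V \<rightarrow> W\<close> extends linearly to the ambient space, so asking \<open>T\<close> to be linear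
  on the whole type is no restriction. The inverse is only required to be continuous, as its
  linearity on \<open>W\<close> is automatic.
\<close>

definition linearly_homeomorphic ::
  "'a::real_normed_vector set \<Rightarrow> 'b::real_normed_vector set \<Rightarrow> bool" where
  "linearly_homeomorphic V W \<longleftrightarrow> (\<exists>T S. linear T \<and> homeomorphism V W T S)"

text \<open>
  Infinite dimension of \<open>X\<close> itself is a standing assumption on the spaces to which the notion is
  applied, not a conjunct: otherwise a finite-dimensional space would count as ``not minimal''.
\<close>

definition minimal_space :: "'a::banach set \<Rightarrow> bool" where
  "minimal_space X \<longleftrightarrow>
    (\<forall>Z\<subseteq>X. subspace Z \<and> closed Z \<and> infinite_dimensional Z \<longrightarrow>
      (\<exists>W\<subseteq>Z. subspace W \<and> closed W \<and> linearly_homeomorphic X W))"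

section \<open>Finitely supported sequences\<close>

typedef c00 = "{x :: nat \<Rightarrow> real. finite {i. x i \<noteq> 0}}"
  morphisms coord Abs_c00
  by (rule exI[of _ "\<lambda>_. 0"]) simp

setup_lifting type_definition_c00

instantiation c00 :: real_vector
begin

lift_definition zero_c00 :: c00 is "\<lambda>_. 0" by simp

lift_definition plus_c00 :: "c00 \<Rightarrow> c00 \<Rightarrow> c00" is "\<lambda>x y i. x i + y i"
  subgoal for x y by (rule finite_subset[of _ "{i. x i \<noteq> 0} \<union> {i. y i \<noteq> 0}"]) auto
  done

lift_definition minus_c00 :: "c00 \<Rightarrow> c00 \<Rightarrow> c00" is "\<lambda>x y i. x i - y i"
  subgoal for x y by (rule finite_subset[of _ "{i. x i \<noteq> 0} \<union> {i. y i \<noteq> 0}"]) auto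
  done

lift_definition uminus_c00 :: "c00 \<Rightarrow> c00" is "\<lambda>x i. - x i" by simp

lift_definition scaleR_c00 :: "real \<Rightarrow> c00 \<Rightarrow> c00" is "\<lambda>c x i. c * x i"
  subgoal for c x by (rule finite_subset[of _ "{i. x i \<noteq> 0}"]) auto
  done

instance
  by standard (transfer; simp add: algebra_simps fun_eq_iff)+

end

lift_definition restrict_c00 :: "nat set \<Rightarrow> c00 \<Rightarrow> c00" is "\<lambda>E x i. if i \<in> E then x i else 0"
  subgoal for E x by (rule finite_subset[of _ "{i. x i \<noteq> 0}"]) auto
  done

definition sup_norm :: "c00 \<Rightarrow> real" where
  "sup_norm x = (SUP i. \<bar>coord x i\<bar>)"

section \<open>The norm of \<open>Ti(2; 1/2)\<close>\<close>

text \<open>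
  \<open>max E < min F\<close>. Empty sets are allowed; in the supremum below they only lower
  the value through the factor \<open>1 / sqrt n\<close>. Since the relation is not transitive through the empty set, \<open>successive\<close> asks for it
  between all pairs and not just between neighbours.
\<close>

definition set_less :: "nat set \<Rightarrow> nat set \<Rightarrow> bool" where
  "set_less E F \<longleftrightarrow> (\<forall>a\<in>E. \<forall>b\<in>F. a < b)"

definition successive :: "nat \<Rightarrow> (nat \<Rightarrow> nat set) \<Rightarrow> bool" where
  "successive n E \<longleftrightarrow> (\<forall>i\<in>{1..n}. \<forall>j\<in>{1..n}. i < j \<longrightarrow> set_less (E i) (E j))"

definition ti_sums :: "(c00 \<Rightarrow> real) \<Rightarrow> c00 \<Rightarrow> real set" where
  "ti_sums N x =
    {1 / (2 * sqrt (real n)) * (\<Sum>i=1..n. N (restrict_c00 (E i) x)) | n E. 1 \<le> n \<and> successive n E}"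

definition ti_equation :: "(c00 \<Rightarrow> real) \<Rightarrow> bool" where
  "ti_equation N \<longleftrightarrow>
    (\<forall>x. bdd_above (ti_sums N x) \<and> N x = max (sup_norm x) (Sup (ti_sums N x)))"

definition ti_norm :: "c00 \<Rightarrow> real" where
  "ti_norm = (THE N. ti_equation N)"

subsection \<open>The implicit equation has exactly one solution\<close>

definition supp :: "c00 \<Rightarrow> nat set" where
  "supp x = {i. coord x i \<noteq> 0}"

lemma finite_supp [simp]: "finite (supp x)"
  using coord[of x] by (simp add: supp_def)

lemma c00_eqI: "(\<And>i. coord x i = coord y i) \<Longrightarrow> x = y"
  by (simp add: coord_inject[symmetric] fun_eq_iff)

lemma coord_simps [simp]:
  "coord 0 i = 0" "coord (x + y) i = coord x i + coord y i" "coord (x - y) i = coord x i - coord y i"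
  "coord (- x) i = - coord x i" "coord (c *\<^sub>R x) i = c * coord x i"
  "coord (restrict_c00 E x) i = (if i \<in> E then coord x i else 0)"
  by (simp_all add: zero_c00.rep_eq plus_c00.rep_eq minus_c00.rep_eq uminus_c00.rep_eq
      scaleR_c00.rep_eq restrict_c00.rep_eq)

lemma restrict_c00_zero [simp]: "restrict_c00 E 0 = 0"
  and restrict_c00_add: "restrict_c00 E (x + y) = restrict_c00 E x + restrict_c00 E y"
  and restrict_c00_scaleR: "restrict_c00 E (c *\<^sub>R x) = c *\<^sub>R restrict_c00 E x"
  by (auto intro!: c00_eqI)

lemma supp_restrict: "supp (restrict_c00 E x) = supp x \<inter> E"
  by (auto simp: supp_def)

lemma bdd_above_coord: "bdd_above (range (\<lambda>i. \<bar>coord x i\<bar>))"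
proof -
  have "range (\<lambda>i. \<bar>coord x i\<bar>) \<subseteq> insert 0 ((\<lambda>i. \<bar>coord x i\<bar>) ` supp x)"
    by (auto simp: supp_def)
  then show ?thesis by (rule bdd_above_mono[rotated]) simp
qed

lemma coord_le_sup_norm: "\<bar>coord x i\<bar> \<le> sup_norm x"
  unfolding sup_norm_def by (rule cSUP_upper[OF _ bdd_above_coord]) simp

lemma sup_norm_leI: "(\<And>i. \<bar>coord x i\<bar> \<le> K) \<Longrightarrow> sup_norm x \<le> K"
  unfolding sup_norm_def by (rule cSUP_least) auto

lemma sup_norm_nonneg: "0 \<le> sup_norm x"
  using coord_le_sup_norm[of x 0] by simp

definition l1_norm :: "c00 \<Rightarrow> real" where
  "l1_norm x = (\<Sum>i\<in>supp x. \<bar>coord x i\<bar>)"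

lemma sup_norm_le_l1_norm: "sup_norm x \<le> l1_norm x"
proof (rule sup_norm_leI)
  fix i
  show "\<bar>coord x i\<bar> \<le> l1_norm x"
  proof (cases "i \<in> supp x")
    case True
    then show ?thesis unfolding l1_norm_def by (intro member_le_sum) auto
  next
    case False
    then show ?thesis unfolding l1_norm_def by (simp add: supp_def sum_nonneg)
  qed
qed

lemma successive_disjoint:
  assumes "successive n E" "i \<in> {1..n}" "j \<in> {1..n}" "i \<noteq> j"
  shows "E i \<inter> E j = {}"
proof (cases i j rule: linorder_cases)
  case less
  with assms have "set_less (E i) (E j)" by (simp add: successive_def)
  then show ?thesis by (fastforce simp: set_less_def)
next
  case greater
  with assms have "set_less (E j) (E i)" by (simp add: successive_def)
  then show ?thesis by (fastforce simp: set_less_def)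
qed (use assms in simp)

lemma sum_l1_norm_restrict_le:
  assumes "successive n E"
  shows "(\<Sum>i=1..n. l1_norm (restrict_c00 (E i) x)) \<le> l1_norm x"
proof -
  have "(\<Sum>i=1..n. l1_norm (restrict_c00 (E i) x))
      = (\<Sum>i=1..n. \<Sum>k\<in>supp x \<inter> E i. \<bar>coord x k\<bar>)"
    unfolding l1_norm_def supp_restrict by (intro sum.cong refl) auto
  also have "\<dots> = (\<Sum>k\<in>(\<Union>i\<in>{1..n}. supp x \<inter> E i). \<bar>coord x k\<bar>)"
  proof (rule sum.UNION_disjoint[symmetric])
    show "\<forall>i\<in>{1..n}. \<forall>j\<in>{1..n}. i \<noteq> j \<longrightarrow> supp x \<inter> E i \<inter> (supp x \<inter> E j) = {}"
      using successive_disjoint[OF assms] by blast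
  qed auto
  also have "\<dots> \<le> l1_norm x"
    unfolding l1_norm_def by (rule sum_mono2) auto
  finally show ?thesis .
qed

lemma ti_sumsI:
  "1 \<le> n \<Longrightarrow> successive n E \<Longrightarrow>
    1 / (2 * sqrt (real n)) * (\<Sum>i=1..n. N (restrict_c00 (E i) x)) \<in> ti_sums N x"
  unfolding ti_sums_def by blast

lemma ti_sumsE:
  assumes "u \<in> ti_sums N x"
  obtains n E where "1 \<le> n" "successive n E"
    "u = 1 / (2 * sqrt (real n)) * (\<Sum>i=1..n. N (restrict_c00 (E i) x))"
  using assms unfolding ti_sums_def by blast

lemma ti_sums_nonempty: "ti_sums N x \<noteq> {}"
  using ti_sumsI[of 1 "\<lambda>_. UNIV" N x] by (auto simp: successive_def)

lemma ti_sums_le_l1_norm: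
  assumes "\<And>x. N x \<le> l1_norm x" "u \<in> ti_sums N x"
  shows "u \<le> l1_norm x"
proof -
  obtain n E where nE: "1 \<le> n" "successive n E"
    and u: "u = 1 / (2 * sqrt (real n)) * (\<Sum>i=1..n. N (restrict_c00 (E i) x))"
    using assms(2) by (rule ti_sumsE)
  have "1 \<le> sqrt (real n)" using nE by simp
  then have n: "1 \<le> 2 * sqrt (real n)" by linarith
  have l: "0 \<le> l1_norm x" by (simp add: l1_norm_def sum_nonneg)
  have "(\<Sum>i=1..n. N (restrict_c00 (E i) x)) \<le> l1_norm x"
    by (rule order_trans[OF sum_mono sum_l1_norm_restrict_le[OF nE(2)]]) (rule assms(1))
  then have "u \<le> 1 / (2 * sqrt (real n)) * l1_norm x"
    unfolding u using n by (intro mult_left_mono) auto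
  also have "\<dots> \<le> 1 * l1_norm x"
    using n l by (intro mult_right_mono) (simp_all add: divide_le_eq)
  finally show ?thesis by simp
qed

lemma bdd_above_ti_sums: "(\<And>x. N x \<le> l1_norm x) \<Longrightarrow> bdd_above (ti_sums N x)"
  using ti_sums_le_l1_norm unfolding bdd_above_def by blast

lemma ti_operator_mono:
  assumes "\<And>x. N x \<le> M x" "\<And>x. M x \<le> l1_norm x"
  shows "max (sup_norm x) (Sup (ti_sums N x)) \<le> max (sup_norm x) (Sup (ti_sums M x))"
proof -
  have "Sup (ti_sums N x) \<le> Sup (ti_sums M x)"
  proof (rule cSup_mono[OF ti_sums_nonempty bdd_above_ti_sums[OF assms(2)]])
    fix u assume "u \<in> ti_sums N x"
    then obtain n E where nE: "1 \<le> n" "successive n E"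
      and u: "u = 1 / (2 * sqrt (real n)) * (\<Sum>i=1..n. N (restrict_c00 (E i) x))"
      by (rule ti_sumsE)
    have "u \<le> 1 / (2 * sqrt (real n)) * (\<Sum>i=1..n. M (restrict_c00 (E i) x))"
      unfolding u by (intro mult_left_mono sum_mono assms(1)) simp
    with ti_sumsI[OF nE] show "\<exists>v\<in>ti_sums M x. u \<le> v" by blast
  qed
  then show ?thesis by auto
qed

lemma ti_equation_exists: "\<exists>N. ti_equation N"
proof -
  define F where "F M x = max (sup_norm x) (Sup (ti_sums M x))" for M x
  define P where "P = {M. \<forall>x. M x \<le> l1_norm x \<and> M x \<le> F M x}"
  define N where "N x = (SUP M\<in>P. M x)" for x
  have F_le: "F M x \<le> l1_norm x" if "\<And>x. M x \<le> l1_norm x" for M x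
    unfolding F_def using sup_norm_le_l1_norm ti_sums_le_l1_norm[of M _ x] that
    by (auto intro!: cSup_least ti_sums_nonempty)
  have F_mono: "F M x \<le> F M' x" if "\<And>x. M x \<le> M' x" "\<And>x. M' x \<le> l1_norm x" for M M' x
    unfolding F_def using that by (rule ti_operator_mono)
  have ne: "P \<noteq> {}"
  proof -
    have "sup_norm \<in> P" by (auto simp: P_def F_def sup_norm_le_l1_norm)
    then show ?thesis by auto
  qed
  have bdd: "bdd_above ((\<lambda>M. M x) ` P)" for x
    by (rule bdd_aboveI[of _ "l1_norm x"]) (auto simp: P_def)
  have N_l1: "N x \<le> l1_norm x" for x
    unfolding N_def using ne by (rule cSUP_least) (auto simp: P_def)
  have upper: "M x \<le> N x" if "M \<in> P" for M x
    unfolding N_def using that by (intro cSUP_upper bdd)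
  have NF: "N x \<le> F N x" for x
    unfolding N_def[of x]
  proof (rule cSUP_least[OF ne])
    fix M assume M: "M \<in> P"
    then have "M x \<le> F M x" by (simp add: P_def)
    also have "\<dots> \<le> F N x" using upper[OF M] N_l1 by (rule F_mono)
    finally show "M x \<le> F N x" .
  qed
  have "F N \<in> P" unfolding P_def using F_le[of N] F_mono[of N "F N"] NF N_l1 by auto
  then have "N x = max (sup_norm x) (Sup (ti_sums N x))" for x
    unfolding F_def[symmetric] using NF upper by (intro antisym) auto
  then have "ti_equation N"
    unfolding ti_equation_def by (intro allI conjI bdd_above_ti_sums N_l1)
  then show ?thesis by blast
qed

lemma ti_equation_nonneg: "ti_equation N \<Longrightarrow> 0 \<le> N x"
  unfolding ti_equation_def using sup_norm_nonneg[of x] by (metis max.coboundedI1)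

lemma ti_equation_sup_norm_le: "ti_equation N \<Longrightarrow> sup_norm x \<le> N x"
  unfolding ti_equation_def by (metis max.cobounded1)

lemma ti_equation_sums_le: "ti_equation N \<Longrightarrow> u \<in> ti_sums N x \<Longrightarrow> u \<le> N x"
  unfolding ti_equation_def by (metis cSup_upper max.coboundedI2)

lemma ti_equation_zero:
  assumes "ti_equation N" shows "N 0 = 0"
proof (rule ccontr)
  assume "N 0 \<noteq> 0"
  then have pos: "0 < N 0" using ti_equation_nonneg[OF assms, of 0] by simp
  have "1 / (2 * sqrt (real 9)) * (\<Sum>i=1..9::nat. N (restrict_c00 {} 0)) \<le> N 0"
    by (rule ti_equation_sums_le[OF assms ti_sumsI[where E = "\<lambda>_. {}"]])
      (auto simp: successive_def set_less_def)
  moreover have "sqrt 9 = (3::real)" by (rule real_sqrt_unique) auto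
  ultimately show False using pos by simp
qed

lemma ti_equation_leI:
  assumes N: "ti_equation N" and A: "supp x \<subseteq> A" and "sup_norm x \<le> K"
    and sums: "\<And>n E. 1 \<le> n \<Longrightarrow> successive n E \<Longrightarrow> (\<And>k. k \<in> {1..n} \<Longrightarrow> \<not> A \<subseteq> E k) \<Longrightarrow>
      1 / (2 * sqrt (real n)) * (\<Sum>i=1..n. N (restrict_c00 (E i) x)) \<le> K"
  shows "N x \<le> K"
proof -
  have K: "0 \<le> K" using sup_norm_nonneg[of x] assms(3) by linarith
  have "u \<le> max (N x / 2) K" if u_in: "u \<in> ti_sums N x" for u
  proof -
    obtain n E where nE: "1 \<le> n" "successive n E"
      and u: "u = 1 / (2 * sqrt (real n)) * (\<Sum>i=1..n. N (restrict_c00 (E i) x))"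
      using u_in by (rule ti_sumsE)
    show ?thesis
    proof (cases "\<exists>k\<in>{1..n}. A \<subseteq> E k")
      case True
      then obtain k where k: "k \<in> {1..n}" "A \<subseteq> E k" by blast
      have "N (restrict_c00 (E i) x) = (if i = k then N x else 0)" if "i \<in> {1..n}" for i
      proof (cases "i = k")
        case True
        have "restrict_c00 (E k) x = x"
          using k(2) A by (intro c00_eqI) (auto simp: supp_def)
        with True show ?thesis by simp
      next
        case False
        with successive_disjoint[OF nE(2) that k(1)] k(2) A
        have "restrict_c00 (E i) x = 0"
          by (intro c00_eqI) (auto simp: supp_def)
        with False show ?thesis by (simp add: ti_equation_zero[OF N])
      qed
      then have "u = 1 / (2 * sqrt (real n)) * N x"
        unfolding u using k(1) by (simp add: sum.delta)
      also have "\<dots> \<le> 1 / 2 * N x"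
        using nE(1) ti_equation_nonneg[OF N, of x]
        by (intro mult_right_mono) (auto simp: field_simps)
      finally show ?thesis by simp
    next
      case False
      then have "u \<le> K" unfolding u using nE by (intro sums) auto
      then show ?thesis by simp
    qed
  qed
  then have "Sup (ti_sums N x) \<le> max (N x / 2) K" by (intro cSup_least ti_sums_nonempty)
  moreover have "N x = max (sup_norm x) (Sup (ti_sums N x))"
    using N by (simp add: ti_equation_def)
  ultimately show ?thesis using K assms(3) by (simp add: max_def split: if_splits)
qed

lemma ti_equation_le:
  assumes N: "ti_equation N" and M: "ti_equation M"
  shows "N x \<le> M x"
proof (induction "card (supp x)" arbitrary: x rule: less_induct)
  case less
  show ?case
  proof (rule ti_equation_leI[OF N order_refl ti_equation_sup_norm_le[OF M]])
    fix n E assume nE: "1 \<le> n" "successive n E"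
      and k: "\<And>k. k \<in> {1..n} \<Longrightarrow> \<not> supp x \<subseteq> E k"
    have "N (restrict_c00 (E i) x) \<le> M (restrict_c00 (E i) x)" if "i \<in> {1..n}" for i
      using k[OF that] by (intro less psubset_card_mono) (auto simp: supp_restrict)
    then have "1 / (2 * sqrt (real n)) * (\<Sum>i=1..n. N (restrict_c00 (E i) x))
        \<le> 1 / (2 * sqrt (real n)) * (\<Sum>i=1..n. M (restrict_c00 (E i) x))"
      by (intro mult_left_mono sum_mono) auto
    also have "\<dots> \<le> M x" by (rule ti_equation_sums_le[OF M ti_sumsI[OF nE]])
    finally show "1 / (2 * sqrt (real n)) * (\<Sum>i=1..n. N (restrict_c00 (E i) x)) \<le> M x" .
  qed
qed

lemma ti_equation_unique: "\<exists>!N. ti_equation N"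
  using ti_equation_exists ti_equation_le by (metis antisym ext)

lemma ti_equation_ti_norm: "ti_equation ti_norm"
  unfolding ti_norm_def by (rule theI'[OF ti_equation_unique])

subsection \<open>The solution is a norm\<close>

lemma ti_norm_triangle: "ti_norm (x + y) \<le> ti_norm x + ti_norm y"
proof (induction "card (supp x \<union> supp y)" arbitrary: x y rule: less_induct)
  case less
  note eq = ti_equation_ti_norm
  show ?case
  proof (rule ti_equation_leI[OF eq, where A = "supp x \<union> supp y"])
    show "supp (x + y) \<subseteq> supp x \<union> supp y" by (auto simp: supp_def)
    show "sup_norm (x + y) \<le> ti_norm x + ti_norm y"
    proof (rule sup_norm_leI)
      fix i
      show "\<bar>coord (x + y) i\<bar> \<le> ti_norm x + ti_norm y"
        using coord_le_sup_norm[of x i] coord_le_sup_norm[of y i]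
          ti_equation_sup_norm_le[OF eq, of x] ti_equation_sup_norm_le[OF eq, of y] by simp
    qed
    fix n E assume nE: "1 \<le> n" "successive n E"
      and k: "\<And>k. k \<in> {1..n} \<Longrightarrow> \<not> supp x \<union> supp y \<subseteq> E k"
    have "ti_norm (restrict_c00 (E i) (x + y))
        \<le> ti_norm (restrict_c00 (E i) x) + ti_norm (restrict_c00 (E i) y)" if "i \<in> {1..n}" for i
      unfolding restrict_c00_add
      using k[OF that] by (intro less psubset_card_mono) (auto simp: supp_restrict)
    then have "1 / (2 * sqrt (real n)) * (\<Sum>i=1..n. ti_norm (restrict_c00 (E i) (x + y)))
        \<le> 1 / (2 * sqrt (real n)) * (\<Sum>i=1..n. ti_norm (restrict_c00 (E i) x) +
            ti_norm (restrict_c00 (E i) y))"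
      by (intro mult_left_mono sum_mono) auto
    also have "\<dots> = 1 / (2 * sqrt (real n)) * (\<Sum>i=1..n. ti_norm (restrict_c00 (E i) x))
        + 1 / (2 * sqrt (real n)) * (\<Sum>i=1..n. ti_norm (restrict_c00 (E i) y))"
      by (simp only: sum.distrib distrib_left)
    also have "\<dots> \<le> ti_norm x + ti_norm y"
      by (intro add_mono ti_equation_sums_le[OF eq ti_sumsI[OF nE]])
    finally show "1 / (2 * sqrt (real n)) * (\<Sum>i=1..n. ti_norm (restrict_c00 (E i) (x + y)))
        \<le> ti_norm x + ti_norm y" .
  qed
qed

lemma ti_norm_scaleR_le: "ti_norm (c *\<^sub>R x) \<le> \<bar>c\<bar> * ti_norm x"
proof (induction "card (supp x)" arbitrary: x rule: less_induct)
  case less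
  note eq = ti_equation_ti_norm
  show ?case
  proof (rule ti_equation_leI[OF eq, where A = "supp x"])
    show "supp (c *\<^sub>R x) \<subseteq> supp x" by (auto simp: supp_def)
    show "sup_norm (c *\<^sub>R x) \<le> \<bar>c\<bar> * ti_norm x"
    proof (rule sup_norm_leI)
      fix i
      have "\<bar>coord x i\<bar> \<le> ti_norm x"
        using coord_le_sup_norm[of x i] ti_equation_sup_norm_le[OF eq, of x] by simp
      then show "\<bar>coord (c *\<^sub>R x) i\<bar> \<le> \<bar>c\<bar> * ti_norm x"
        by (simp add: abs_mult mult_left_mono)
    qed
    fix n E assume nE: "1 \<le> n" "successive n E"
      and k: "\<And>k. k \<in> {1..n} \<Longrightarrow> \<not> supp x \<subseteq> E k"
    have "ti_norm (restrict_c00 (E i) (c *\<^sub>R x)) \<le> \<bar>c\<bar> * ti_norm (restrict_c00 (E i) x)"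
      if "i \<in> {1..n}" for i
      unfolding restrict_c00_scaleR
      using k[OF that] by (intro less psubset_card_mono) (auto simp: supp_restrict)
    then have "1 / (2 * sqrt (real n)) * (\<Sum>i=1..n. ti_norm (restrict_c00 (E i) (c *\<^sub>R x)))
        \<le> 1 / (2 * sqrt (real n)) * (\<Sum>i=1..n. \<bar>c\<bar> * ti_norm (restrict_c00 (E i) x))"
      by (intro mult_left_mono sum_mono) auto
    also have "\<dots> = \<bar>c\<bar> * (1 / (2 * sqrt (real n)) * (\<Sum>i=1..n. ti_norm (restrict_c00 (E i) x)))"
      by (simp only: sum_distrib_left[symmetric] mult.left_commute)
    also have "\<dots> \<le> \<bar>c\<bar> * ti_norm x"
      by (intro mult_left_mono ti_equation_sums_le[OF eq ti_sumsI[OF nE]]) simp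
    finally show "1 / (2 * sqrt (real n)) * (\<Sum>i=1..n. ti_norm (restrict_c00 (E i) (c *\<^sub>R x)))
        \<le> \<bar>c\<bar> * ti_norm x" .
  qed
qed

lemma ti_norm_scaleR: "ti_norm (c *\<^sub>R x) = \<bar>c\<bar> * ti_norm x"
proof (cases "c = 0")
  case True
  then show ?thesis by (simp add: ti_equation_zero[OF ti_equation_ti_norm])
next
  case False
  have "ti_norm x \<le> \<bar>inverse c\<bar> * ti_norm (c *\<^sub>R x)"
    using ti_norm_scaleR_le[of "inverse c" "c *\<^sub>R x"] False by simp
  then have "\<bar>c\<bar> * ti_norm x \<le> ti_norm (c *\<^sub>R x)" using False by (simp add: field_simps)
  with ti_norm_scaleR_le[of c x] show ?thesis by simp
qed

lemma ti_norm_eq_zero_iff: "ti_norm x = 0 \<longleftrightarrow> x = 0"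
proof
  assume "ti_norm x = 0"
  then have "coord x i = 0" for i
    using coord_le_sup_norm[of x i] ti_equation_sup_norm_le[OF ti_equation_ti_norm, of x] by simp
  then show "x = 0" by (intro c00_eqI) simp
qed (simp add: ti_equation_zero[OF ti_equation_ti_norm])

section \<open>The space \<open>Y = Ti(2; 1/2)\<close>\<close>

instantiation c00 :: real_normed_vector
begin

definition norm_c00 :: "c00 \<Rightarrow> real" where
  "norm_c00 = ti_norm"

definition dist_c00 :: "c00 \<Rightarrow> c00 \<Rightarrow> real" where
  "dist_c00 x y = norm (x - y)"

definition sgn_c00 :: "c00 \<Rightarrow> c00" where
  "sgn_c00 x = inverse (norm x) *\<^sub>R x"

definition uniformity_c00 :: "(c00 \<times> c00) filter" where
  "uniformity_c00 = (INF e\<in>{0<..}. principal {(x, y). dist x y < e})"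

definition open_c00 :: "c00 set \<Rightarrow> bool" where
  "open_c00 U \<longleftrightarrow> (\<forall>x\<in>U. eventually (\<lambda>(x', y). x' = x \<longrightarrow> y \<in> U) uniformity)"

instance
  by standard (auto simp: norm_c00_def dist_c00_def sgn_c00_def uniformity_c00_def open_c00_def
      ti_norm_triangle ti_norm_scaleR ti_norm_eq_zero_iff)

end

type_synonym ti_space = "c00 banach_completion"

lift_definition unit_vec :: "nat \<Rightarrow> c00" is "\<lambda>k i. if i = k then 1 else 0"
  subgoal for k by (rule finite_subset[of _ "{k}"]) auto
  done

lemma infinite_dimensional_ti_space: "infinite_dimensional (UNIV :: ti_space set)"
proof -
  have coord_unit: "coord (unit_vec k) i = (if i = k then 1 else 0)" for k i
    by (simp add: unit_vec.rep_eq)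
  have coord_sum: "coord (\<Sum>v\<in>t. f v) i = (\<Sum>v\<in>t. coord (f v) i)" for f :: "c00 \<Rightarrow> c00" and t i
    by (induction t rule: infinite_finite_induct) auto
  have inj_unit: "inj unit_vec"
    by (rule injI) (metis coord_unit zero_neq_one)
  have ind: "independent (range unit_vec)"
    unfolding independent_explicit_module
  proof (intro allI impI)
    fix t u v
    assume t: "finite t" "t \<subseteq> range unit_vec" "(\<Sum>w\<in>t. u w *\<^sub>R w) = 0" "v \<in> t"
    then obtain k where k: "v = unit_vec k" by blast
    have "0 = coord (\<Sum>w\<in>t. u w *\<^sub>R w) k" using t(3) by simp
    also have "\<dots> = (\<Sum>w\<in>t. if w = v then u w else 0)"
      unfolding coord_sum using t(2) k
      by (intro sum.cong) (auto simp: coord_unit inj_eq[OF inj_unit])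
    also have "\<dots> = u v" using t(1,4) by simp
    finally show "u v = 0" by simp
  qed
  have inj_embed: "inj (completion_embed :: c00 \<Rightarrow> ti_space)"
    unfolding linear_injective_0[OF linear_completion_embed]
    by (metis norm_completion_embed norm_eq_zero)
  have "independent ((completion_embed :: c00 \<Rightarrow> ti_space) ` range unit_vec)"
    using linear_independent_injective_image[OF linear_completion_embed ind]
      inj_embed inj_on_subset by blast
  moreover have "infinite ((completion_embed :: c00 \<Rightarrow> ti_space) ` range unit_vec)"
    using inj_embed inj_unit by (metis finite_imageD infinite_UNIV_nat inj_on_subset subset_UNIV)
  ultimately show ?thesis
    unfolding infinite_dimensional_def using real_vector.independent_span_bound by blast
qed

end

theory Submission
  imports Defs "HOL-Library.Discrete_Functions" "HOL-Real_Asymp.Real_Asymp"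
begin

text \<open>
  Write \<open>e\<^sub>i\<close> for the unit vectors of \<open>Y\<close>. The idea is that a suitable subspace \<open>Z\<close> of \<open>Y\<close> can
  contain a copy of \<open>Y\<close> only if the \<open>e\<^sub>i\<close> span a Hilbert space, which they do not.

  Vectors that are flat, meaning of small sup norm, behave in \<open>Y\<close> like vectors of a Hilbert space.
  A successive decomposition satisfies an upper \<open>\<ell>\<^sub>2\<close> estimate (\<open>norm_sq_le_blocks\<close>).
  Conversely, if successive \<open>x\<^sub>1, \<dots>, x\<^sub>m\<close> are flat enough, each \<open>x\<^sub>i\<close> can be cut,
  up to a remainder of norm at most \<open>\<delta>\<close>, into successive pieces whose norms lie between \<open>\<delta>\<close> and
  \<open>2 \<delta>\<close>, where \<open>\<delta>\<close> is the same for all \<open>i\<close> and small compared with \<open>\<parallel>x\<^sub>i\<parallel>\<close>. By the upper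
  estimate there are at least a constant times \<open>\<parallel>x\<^sub>i\<parallel>\<^sup>2 / \<delta>\<^sup>2\<close> of them. If there are \<open>n\<close> pieces altogether, one step of the implicit equation for the norm gives
  \<open>\<parallel>x\<^sub>1 + \<dots> + x\<^sub>m\<parallel> \<ge> n \<delta> / (2 \<surd>n)\<close>, which is at least a
  constant times \<open>(\<Sum> \<parallel>x\<^sub>i\<parallel>\<^sup>2)\<^sup>1\<^sup>/\<^sup>2\<close> (\<open>flat_blocks_lower_l2\<close>).

  The \<open>e\<^sub>i\<close> satisfy no such lower estimate. The coefficients \<open>ruler J t\<close>, the sum of the \<open>2\<^sup>j\<close> with
  \<open>j < J\<close> and \<open>4\<^sup>j\<close> dividing \<open>t\<close>, have \<open>J\<close> layers, each with \<open>\<ell>\<^sub>2\<close> norm about \<open>2\<^sup>K\<close> on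
  \<open>{0..<4\<^sup>K}\<close>, \<open>K = J - 1\<close>, and so their \<open>\<ell>\<^sub>2\<close> norm is at least \<open>\<surd>J 2\<^sup>K\<close>. But a
  decomposition into \<open>n\<close> sets is well adapted only to the layer with about \<open>n\<close> nonzero terms. The
  sparser layers contribute little because their \<open>\<ell>\<^sub>1\<close> norm is small, and on the denser ones the
  factor \<open>1/2\<close> in the equation is lost at each step. So the layers do not add up,
  and the norm in \<open>Y\<close> is at most \<open>6 \<cdot> 2\<^sup>K\<close>, uniformly in \<open>K\<close> (\<open>norm_ruler_le\<close>).

  For \<open>Z\<close> take the closure of the finitely supported sequences that are constant on each
  interval \<open>[k\<^sup>2, (k+1)\<^sup>2)\<close>. Their coordinates are controlled by the norm times a null sequence.
  If \<open>T\<close> embeds \<open>Y\<close> into \<open>Z\<close>, differences of suitable \<open>T e\<^sub>i\<close> are therefore as flat and as nearly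
  disjoint as desired. Hence linear combinations of them dominate the \<open>\<ell>\<^sub>2\<close> norm of the
  coefficients, while \<open>T\<close> bounds them by the same combinations of the \<open>e\<^sub>i\<close>. The ruler coefficients
  contradict this (\<open>no_flat_copy_of_basis\<close>).
\<close>

section \<open>The norm on finitely supported sequences\<close>

text \<open>
  A family in which one set contains the whole support can be left out of the supremum, since it
  yields at most half of the norm. In every other family each set misses part of the support, so
  this rule turns upper estimates of the norm into inductions on the size of the support.
\<close>
lemma norm_c00_leI:
  assumes "supp x \<subseteq> A" "sup_norm x \<le> K"
    and "\<And>n E. 1 \<le> n \<Longrightarrow> successive n E \<Longrightarrow> (\<And>k. k \<in> {1..n} \<Longrightarrow> \<not> A \<subseteq> E k) \<Longrightarrow>
      (\<Sum>i=1..n. norm (restrict_c00 (E i) x)) \<le> 2 * sqrt (real n) * K"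
  shows "norm x \<le> K"
  unfolding norm_c00_def
proof (rule ti_equation_leI[OF ti_equation_ti_norm assms(1,2)])
  fix n E assume n: "1 \<le> n" "successive n E" "\<And>k. k \<in> {1..n} \<Longrightarrow> \<not> A \<subseteq> E k"
  from assms(3)[OF this] n(1)
  show "1 / (2 * sqrt (real n)) * (\<Sum>i=1..n. ti_norm (restrict_c00 (E i) x)) \<le> K"
    unfolding norm_c00_def by (simp add: field_simps)
qed

lemma sum_norm_restrict_le:
  assumes "successive n E"
  shows "(\<Sum>i=1..n. norm (restrict_c00 (E i) x)) \<le> 2 * sqrt (real n) * norm x"
proof (cases "n = 0")
  case False
  with ti_equation_sums_le[OF ti_equation_ti_norm ti_sumsI[OF _ assms, of ti_norm x]]
  show ?thesis unfolding norm_c00_def by (simp add: field_simps)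
qed simp

lemma abs_coord_le_norm: "\<bar>coord x i\<bar> \<le> norm x"
  unfolding norm_c00_def
  using coord_le_sup_norm[of x i] ti_equation_sup_norm_le[OF ti_equation_ti_norm, of x] by linarith

text \<open>
  The \<open>\<le>\<close> half of subsymmetry of the basis, together with unconditionality: sets for \<open>y\<close> pull back
  along \<open>p\<close> to sets for \<open>x\<close> that are still successive.
\<close>
lemma norm_c00_spread:
  assumes p: "strict_mono p" and "\<And>i. \<bar>coord y (p i)\<bar> \<le> \<bar>coord x i\<bar>" and "supp y \<subseteq> range p"
  shows "norm y \<le> norm x"
  using assms(2,3)
proof (induction "card (supp y)" arbitrary: x y rule: less_induct)
  case less
  show ?case
  proof (rule norm_c00_leI[OF order_refl])
    show "sup_norm y \<le> norm x"
    proof (rule sup_norm_leI)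
      fix t
      show "\<bar>coord y t\<bar> \<le> norm x"
      proof (cases "t \<in> range p")
        case True
        then obtain i where "t = p i" by blast
        then show ?thesis using less.prems(1)[of i] abs_coord_le_norm[of x i] by simp
      next
        case False
        then have "coord y t = 0" using less.prems(2) by (auto simp: supp_def)
        then show ?thesis by simp
      qed
    qed
    fix n E assume n: "1 \<le> n" "successive n E" "\<And>k. k \<in> {1..n} \<Longrightarrow> \<not> supp y \<subseteq> E k"
    have "successive n (\<lambda>j. p -` E j)"
      unfolding successive_def set_less_def
    proof (intro ballI impI)
      fix i j a b assume "i \<in> {1..n}" "j \<in> {1..n}" "i < j" "a \<in> p -` E i" "b \<in> p -` E j"
      then have "p a < p b" using n(2) unfolding successive_def set_less_def by blast
      then show "a < b" using strict_mono_less[OF p, of a b] by blast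
    qed
    then have "(\<Sum>j=1..n. norm (restrict_c00 (p -` E j) x)) \<le> 2 * sqrt (real n) * norm x"
      by (rule sum_norm_restrict_le)
    moreover have "norm (restrict_c00 (E j) y) \<le> norm (restrict_c00 (p -` E j) x)"
      if "j \<in> {1..n}" for j
    proof (rule less.hyps)
      show "card (supp (restrict_c00 (E j) y)) < card (supp y)"
        using n(3)[OF that] by (intro psubset_card_mono) (auto simp: supp_restrict)
    qed (use less.prems in \<open>auto simp: supp_restrict\<close>)
    then have "(\<Sum>j=1..n. norm (restrict_c00 (E j) y)) \<le> (\<Sum>j=1..n. norm (restrict_c00 (p -` E j) x))"
      by (rule sum_mono)
    ultimately show "(\<Sum>j=1..n. norm (restrict_c00 (E j) y)) \<le> 2 * sqrt (real n) * norm x"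
      by linarith
  qed
qed

corollary norm_c00_mono:
  assumes "\<And>i. \<bar>coord y i\<bar> \<le> \<bar>coord x i\<bar>"
  shows "norm y \<le> norm x"
  using norm_c00_spread[of id y x] assms by (simp add: strict_mono_def)

lemma norm_restrict_mono:
  assumes "A \<subseteq> B" shows "norm (restrict_c00 A x) \<le> norm (restrict_c00 B x)"
  using assms by (intro norm_c00_mono) auto

lemma restrict_c00_restrict [simp]:
  "restrict_c00 A (restrict_c00 B x) = restrict_c00 (A \<inter> B) x"
  by (rule c00_eqI) auto

lemma restrict_c00_empty [simp]: "restrict_c00 {} x = 0"
  by (rule c00_eqI) simp

lemma restrict_c00_cong:
  assumes "A \<inter> supp x = B \<inter> supp x" shows "restrict_c00 A x = restrict_c00 B x"
  using assms by (intro c00_eqI) (auto simp: supp_def)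

lemma coord_sum: "coord (\<Sum>i\<in>I. f i) t = (\<Sum>i\<in>I. coord (f i) t)"
  by (induction I rule: infinite_finite_induct) auto

lemma coord_unit_vec: "coord (unit_vec k) i = (if i = k then 1 else 0)"
  by (simp add: unit_vec.rep_eq)

lemma norm_unit_vec: "norm (unit_vec k) = 1"
proof (rule antisym)
  show "1 \<le> norm (unit_vec k)" using abs_coord_le_norm[of "unit_vec k" k] by (simp add: coord_unit_vec)
  show "norm (unit_vec k) \<le> 1"
  proof (rule norm_c00_leI[where A = "{k}"])
    fix n E assume "1 \<le> n" "successive n E" and k: "\<And>j. j \<in> {1..n} \<Longrightarrow> \<not> {k} \<subseteq> E j"
    have "(\<Sum>i=1..n. norm (restrict_c00 (E i) (unit_vec k))) = 0"
      using k by (intro sum.neutral ballI) (auto intro!: c00_eqI simp: coord_unit_vec)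
    then show "(\<Sum>i=1..n. norm (restrict_c00 (E i) (unit_vec k))) \<le> 2 * sqrt (real n) * 1" by simp
  qed (auto simp: supp_def coord_unit_vec intro: sup_norm_leI)
qed

lemma restrict_c00_singleton: "restrict_c00 {i} x = coord x i *\<^sub>R unit_vec i"
  by (rule c00_eqI) (simp add: coord_unit_vec)

lemma c00_expand:
  assumes "finite A" "supp x \<subseteq> A" shows "x = (\<Sum>i\<in>A. coord x i *\<^sub>R unit_vec i)"
  using assms by (intro c00_eqI) (auto simp: coord_sum coord_unit_vec supp_def if_distrib cong: if_cong)

lemma norm_le_sum_abs_coord:
  assumes "finite A" "supp x \<subseteq> A" shows "norm x \<le> (\<Sum>i\<in>A. \<bar>coord x i\<bar>)"
proof -
  have "norm x = norm (\<Sum>i\<in>A. coord x i *\<^sub>R unit_vec i)" using c00_expand[OF assms] by simp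
  also have "\<dots> \<le> (\<Sum>i\<in>A. norm (coord x i *\<^sub>R unit_vec i))" by (rule norm_sum)
  finally show ?thesis by (simp add: norm_unit_vec)
qed

text \<open>
  Reindexes the defining inequality of the norm by an arbitrary finite set of naturals, as is
  convenient when only some members of a successive family matter.
\<close>
lemma sum_norm_restrict_le_card:
  fixes J :: "nat set"
  assumes J: "finite J" and less: "\<And>i j. i \<in> J \<Longrightarrow> j \<in> J \<Longrightarrow> i < j \<Longrightarrow> set_less (E i) (E j)"
  shows "(\<Sum>j\<in>J. norm (restrict_c00 (E j) x)) \<le> 2 * sqrt (real (card J)) * norm x"
proof -
  define xs where "xs = sorted_list_of_set J"
  have xs: "set xs = J" "sorted xs" "distinct xs" "length xs = card J"
    using J by (auto simp: xs_def)
  have bij: "bij_betw ((!) xs) {..<card J} J"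
    using xs by (intro bij_betw_nth) auto
  have "successive (card J) (\<lambda>i. E (xs ! (i - 1)))"
    unfolding successive_def
  proof (intro ballI impI less)
    fix i j assume ij: "i \<in> {1..card J}" "j \<in> {1..card J}" "i < j"
    then have lt: "i - 1 < j - 1" "i - 1 < length xs" "j - 1 < length xs" using xs(4) by auto
    show "xs ! (i - 1) \<in> J" "xs ! (j - 1) \<in> J" using lt(2,3) xs(1) nth_mem by blast+
    have "sorted_wrt (<) xs" using xs by (simp add: strict_sorted_iff)
    from sorted_wrt_nth_less[OF this lt(1,3)] show "xs ! (i - 1) < xs ! (j - 1)" .
  qed
  from sum_norm_restrict_le[OF this, of x]
  have "(\<Sum>i<card J. norm (restrict_c00 (E (xs ! i)) x)) \<le> 2 * sqrt (real (card J)) * norm x"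
    by (simp add: sum.atLeast1_atMost_eq)
  with sum.reindex_bij_betw[OF bij, of "\<lambda>j. norm (restrict_c00 (E j) x)"] show ?thesis by simp
qed

section \<open>The upper estimate\<close>

text \<open>
  The monotone map \<open>\<pi>\<close> encodes a decomposition into successive blocks \<open>x\<^sub>i\<close>, its fibres being the
  blocks' intervals. Let \<open>E\<^sub>1 < \<dots> < E\<^sub>n\<close>. Blocks that meet only one \<open>E\<^sub>j\<close> are handled
  by the induction hypothesis inside that \<open>E\<^sub>j\<close>. A block \<open>x\<^sub>i\<close> that meets \<open>n\<^sub>i \<ge> 2\<close> of the sets
  contributes at most \<open>2 \<surd>n\<^sub>i \<parallel>x\<^sub>i\<parallel>\<close>, and as the sets are successive, the sum of these
  \<open>n\<^sub>i\<close> is at most \<open>2 n\<close>. With \<open>C\<close> for the constant, Cauchy-Schwarz closes the induction as soon as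
  \<open>C\<^sup>2 + 8 \<le> 4 C\<^sup>2\<close>, for example for \<open>C = 2\<close>.
\<close>
lemma norm_sq_le_blocks:
  fixes \<pi> :: "nat \<Rightarrow> nat"
  assumes \<pi>: "mono \<pi>" and "finite I" and "\<pi> ` supp x \<subseteq> I"
  shows "(norm x)\<^sup>2 \<le> 4 * (\<Sum>i\<in>I. (norm (restrict_c00 {t. \<pi> t = i} x))\<^sup>2)"
  using assms(2,3)
proof (induction "card (supp x)" arbitrary: x I rule: less_induct)
  case less
  note fin = less.prems(1) and sub = less.prems(2)
  define b where "b i = norm (restrict_c00 {t. \<pi> t = i} x)" for i
  define Q where "Q = sqrt (\<Sum>i\<in>I. (b i)\<^sup>2)"
  have Q0: "0 \<le> Q" by (simp add: Q_def sum_nonneg)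
  have Q2: "Q\<^sup>2 = (\<Sum>i\<in>I. (b i)\<^sup>2)" by (simp add: Q_def sum_nonneg)
  have "norm x \<le> 2 * Q"
  proof (rule norm_c00_leI[OF order_refl])
    show "sup_norm x \<le> 2 * Q"
    proof (rule sup_norm_leI)
      fix t
      show "\<bar>coord x t\<bar> \<le> 2 * Q"
      proof (cases "t \<in> supp x")
        case True
        then have "\<pi> t \<in> I" using sub by blast
        then have "(b (\<pi> t))\<^sup>2 \<le> Q\<^sup>2" unfolding Q2 using fin by (intro member_le_sum) auto
        then have "b (\<pi> t) \<le> Q" using Q0 by (rule power2_le_imp_le)
        moreover have "\<bar>coord x t\<bar> \<le> b (\<pi> t)"
          unfolding b_def using abs_coord_le_norm[of "restrict_c00 {s. \<pi> s = \<pi> t} x" t] by simp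
        ultimately show ?thesis using Q0 by linarith
      qed (use Q0 in \<open>simp add: supp_def\<close>)
    qed
    fix n E assume n: "1 \<le> n" "successive n E" and proper: "\<And>k. k \<in> {1..n} \<Longrightarrow> \<not> supp x \<subseteq> E k"
    \<comment> \<open>\<open>J i\<close>: the sets that meet block \<open>i\<close>. \<open>S\<close>: the blocks that are cut by more than one set.\<close>
    define J where "J i = {j\<in>{1..n}. \<exists>t\<in>E j. \<pi> t = i \<and> t \<in> supp x}" for i
    define S where "S = {i\<in>I. 2 \<le> card (J i)}"
    have finJ [simp]: "finite (J i)" for i by (simp add: J_def)
    have finS [simp]: "finite S" using fin by (simp add: S_def)
    \<comment> \<open>Two blocks can share a set \<open>E j\<close> only if it is the last one to meet the earlier block.\<close>
    have no_overlap: False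
      if ov: "i < i'" "j \<in> J i" "j \<in> J i'" "j < j'" "j' \<in> J i" for i i' j j'
    proof -
      obtain t' where t': "t' \<in> E j" "\<pi> t' = i'" using ov(3) by (auto simp: J_def)
      obtain t where t: "t \<in> E j'" "\<pi> t = i" using ov(5) by (auto simp: J_def)
      have "set_less (E j) (E j')" using n(2) ov by (auto simp: successive_def J_def)
      then have "t' < t" using t t' by (auto simp: set_less_def)
      then have "i' \<le> i" using monoD[OF \<pi>, of t' t] t t' by simp
      with ov show False by simp
    qed
    \<comment> \<open>Without their last sets, the \<open>J i\<close> become disjoint, at the cost of at most half of their size.\<close>
    have count: "(\<Sum>i\<in>S. card (J i)) \<le> 2 * n"
    proof -
      define J' where "J' i = J i - {Max (J i)}" for i
      have Max_in: "Max (J i) \<in> J i" if "i \<in> S" for i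
        using that by (intro Max_in) (auto simp: S_def)
      have lt_Max: "j < Max (J i)" if "j \<in> J' i" for i j
      proof -
        have "j \<in> J i" "j \<noteq> Max (J i)" using that by (auto simp: J'_def)
        then show ?thesis using Max_ge[OF finJ[of i], of j] by (meson order_le_neq_trans)
      qed
      have disj: "J' i \<inter> J' i' = {}" if "i \<in> S" "i' \<in> S" "i < i'" for i i'
      proof (rule ccontr)
        assume "\<not> ?thesis"
        then obtain j where j: "j \<in> J' i" "j \<in> J i" "j \<in> J i'" by (auto simp: J'_def)
        show False by (rule no_overlap[OF that(3) j(2,3) lt_Max[OF j(1)] Max_in[OF that(1)]])
      qed
      have "(\<Sum>i\<in>S. card (J' i)) = card (\<Union>i\<in>S. J' i)"
      proof (rule card_UN_disjoint[symmetric])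
        show "\<forall>i\<in>S. \<forall>i'\<in>S. i \<noteq> i' \<longrightarrow> J' i \<inter> J' i' = {}"
          using disj by (metis Int_commute linorder_neqE_nat)
      qed (auto simp: J'_def)
      also have "\<dots> \<le> card {1..n}" by (rule card_mono) (auto simp: J'_def J_def)
      finally have "2 * (\<Sum>i\<in>S. card (J' i)) \<le> 2 * n" by simp
      moreover have "card (J i) \<le> 2 * card (J' i)" if "i \<in> S" for i
        using that Max_in[OF that] by (auto simp: J'_def S_def)
      then have "(\<Sum>i\<in>S. card (J i)) \<le> (\<Sum>i\<in>S. 2 * card (J' i))" by (rule sum_mono)
      ultimately show ?thesis by (simp add: sum_distrib_left)
    qed
    \<comment> \<open>The uncut blocks that meet \<open>E j\<close>.\<close>
    define R where "R j = {i\<in>I - S. j \<in> J i}" for j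
    have piece: "norm (restrict_c00 (E j) x)
        \<le> 2 * sqrt (\<Sum>i\<in>R j. (b i)\<^sup>2) + (\<Sum>i\<in>S. norm (restrict_c00 (E j) (restrict_c00 {t. \<pi> t = i} x)))"
      if j: "j \<in> {1..n}" for j
    proof -
      define x' where "x' = restrict_c00 (E j \<inter> {t. \<pi> t \<notin> S}) x"
      have eq: "restrict_c00 (E j) x = x' + (\<Sum>i\<in>S. restrict_c00 (E j) (restrict_c00 {t. \<pi> t = i} x))"
        unfolding x'_def by (rule c00_eqI) (auto simp: coord_sum)
      have "(norm x')\<^sup>2 \<le> 4 * (\<Sum>i\<in>R j. (norm (restrict_c00 {t. \<pi> t = i} x'))\<^sup>2)"
      proof (rule less.hyps)
        show "card (supp x') < card (supp x)"
          unfolding x'_def using proper[OF j] by (intro psubset_card_mono) (auto simp: supp_restrict)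
        show "finite (R j)" using fin by (simp add: R_def)
        show "\<pi> ` supp x' \<subseteq> R j" using sub j by (auto simp: x'_def supp_restrict R_def J_def)
      qed
      also have "\<dots> \<le> 4 * (\<Sum>i\<in>R j. (b i)\<^sup>2)"
        unfolding b_def x'_def by (intro mult_left_mono sum_mono power_mono)
          (auto intro!: norm_restrict_mono)
      finally have "norm x' \<le> sqrt (4 * (\<Sum>i\<in>R j. (b i)\<^sup>2))" by (rule real_le_rsqrt)
      then have "norm x' \<le> 2 * sqrt (\<Sum>i\<in>R j. (b i)\<^sup>2)" by (simp add: real_sqrt_mult)
      with eq norm_triangle_ineq[of x' "\<Sum>i\<in>S. restrict_c00 (E j) (restrict_c00 {t. \<pi> t = i} x)"]
        norm_sum[of "\<lambda>i. restrict_c00 (E j) (restrict_c00 {t. \<pi> t = i} x)" S]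
      show ?thesis by simp
    qed
    define u where "u = (\<Sum>i\<in>I - S. (b i)\<^sup>2)"
    define v where "v = (\<Sum>i\<in>S. (b i)\<^sup>2)"
    have uv: "u + v = Q\<^sup>2" "0 \<le> u" "0 \<le> v"
      unfolding u_def v_def Q2 using fin
      by (auto simp: S_def sum_nonneg intro!: sum.subset_diff[symmetric])
    have "(\<Sum>j=1..n. sqrt (\<Sum>i\<in>R j. (b i)\<^sup>2)) \<le> sqrt n * sqrt u"
    proof -
      have "(\<Sum>j=1..n. \<Sum>i\<in>R j. (b i)\<^sup>2) = (\<Sum>i\<in>I - S. \<Sum>j | j \<in> {1..n} \<and> j \<in> J i. (b i)\<^sup>2)"
        unfolding R_def using fin by (intro sum.swap_restrict) auto
      also have "\<dots> \<le> u"
        unfolding u_def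
      proof (rule sum_mono)
        fix i assume "i \<in> I - S"
        then have "card (J i) \<le> 1" by (auto simp: S_def)
        moreover have "{j. j \<in> {1..n} \<and> j \<in> J i} = J i" by (auto simp: J_def)
        ultimately show "(\<Sum>j | j \<in> {1..n} \<and> j \<in> J i. (b i)\<^sup>2) \<le> (b i)\<^sup>2"
          by (simp add: mult_left_le_one_le)
      qed
      finally have le: "(\<Sum>j=1..n. \<Sum>i\<in>R j. (b i)\<^sup>2) \<le> u" .
      have "(\<Sum>j=1..n. 1 * sqrt (\<Sum>i\<in>R j. (b i)\<^sup>2))\<^sup>2
          \<le> (\<Sum>j=1..n. 1\<^sup>2) * (\<Sum>j=1..n. (sqrt (\<Sum>i\<in>R j. (b i)\<^sup>2))\<^sup>2)"
        by (rule Cauchy_Schwarz_ineq_sum)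
      also have "\<dots> \<le> n * u" using le by (simp add: sum_nonneg mult_left_mono)
      finally show ?thesis by (simp add: real_le_rsqrt real_sqrt_mult[symmetric])
    qed
    moreover have "(\<Sum>j=1..n. \<Sum>i\<in>S. norm (restrict_c00 (E j) (restrict_c00 {t. \<pi> t = i} x)))
        \<le> 2 * (sqrt (2 * n) * sqrt v)"
    proof -
      have "(\<Sum>j=1..n. \<Sum>i\<in>S. norm (restrict_c00 (E j) (restrict_c00 {t. \<pi> t = i} x)))
          = (\<Sum>i\<in>S. \<Sum>j=1..n. norm (restrict_c00 (E j) (restrict_c00 {t. \<pi> t = i} x)))"
        by (rule sum.swap)
      also have "\<dots> \<le> (\<Sum>i\<in>S. 2 * sqrt (card (J i)) * b i)"
      proof (rule sum_mono)
        fix i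
        have "(\<Sum>j=1..n. norm (restrict_c00 (E j) (restrict_c00 {t. \<pi> t = i} x)))
            = (\<Sum>j\<in>J i. norm (restrict_c00 (E j) (restrict_c00 {t. \<pi> t = i} x)))"
          by (rule sum.mono_neutral_right) (auto intro!: c00_eqI simp: J_def supp_def split: if_splits)
        also have "\<dots> \<le> 2 * sqrt (card (J i)) * b i"
          unfolding b_def using n(2)
          by (intro sum_norm_restrict_le_card) (auto simp: J_def successive_def)
        finally show "(\<Sum>j=1..n. norm (restrict_c00 (E j) (restrict_c00 {t. \<pi> t = i} x)))
          \<le> 2 * sqrt (card (J i)) * b i" .
      qed
      also have "\<dots> = 2 * (\<Sum>i\<in>S. sqrt (card (J i)) * b i)" by (simp add: sum_distrib_left mult.assoc)
      also have "(\<Sum>i\<in>S. sqrt (card (J i)) * b i) \<le> sqrt (2 * n) * sqrt v"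
      proof -
        have "(\<Sum>i\<in>S. sqrt (card (J i)) * b i)\<^sup>2 \<le> (\<Sum>i\<in>S. (sqrt (card (J i)))\<^sup>2) * (\<Sum>i\<in>S. (b i)\<^sup>2)"
          by (rule Cauchy_Schwarz_ineq_sum)
        also have "(\<Sum>i\<in>S. (sqrt (card (J i)))\<^sup>2) = real (\<Sum>i\<in>S. card (J i))" by simp
        also have "\<dots> * (\<Sum>i\<in>S. (b i)\<^sup>2) \<le> real (2 * n) * v"
          unfolding v_def using count by (intro mult_right_mono sum_nonneg) (auto simp only: of_nat_le_iff zero_le_power2)
        finally show ?thesis by (simp add: real_le_rsqrt real_sqrt_mult[symmetric])
      qed
      finally show ?thesis by simp
    qed
    moreover have "sqrt n * sqrt u + sqrt (2 * n) * sqrt v \<le> sqrt n * (2 * Q)"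
    proof -
      have cs: "(p + r * q)\<^sup>2 \<le> 3 * (p\<^sup>2 + q\<^sup>2)" if "r\<^sup>2 = 2" for p q r :: real
      proof -
        have "3 * (p\<^sup>2 + q\<^sup>2) - (p + r * q)\<^sup>2 = (r * p - q)\<^sup>2 + (2 - r\<^sup>2) * (p\<^sup>2 + q\<^sup>2)"
          by (simp add: power2_eq_square algebra_simps)
        then have "0 \<le> 3 * (p\<^sup>2 + q\<^sup>2) - (p + r * q)\<^sup>2" using that by simp
        then show ?thesis by simp
      qed
      have "(sqrt u + sqrt 2 * sqrt v)\<^sup>2 \<le> 3 * ((sqrt u)\<^sup>2 + (sqrt v)\<^sup>2)" by (rule cs) simp
      also have "\<dots> \<le> (2 * Q)\<^sup>2" using uv by (simp add: power_mult_distrib)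
      finally have "sqrt u + sqrt 2 * sqrt v \<le> 2 * Q" by (rule power2_le_imp_le) (use Q0 in simp)
      then have "sqrt n * (sqrt u + sqrt 2 * sqrt v) \<le> sqrt n * (2 * Q)" by (intro mult_left_mono) auto
      then show ?thesis by (simp add: real_sqrt_mult algebra_simps)
    qed
    moreover have "(\<Sum>j=1..n. norm (restrict_c00 (E j) x)) \<le> 2 * (\<Sum>j=1..n. sqrt (\<Sum>i\<in>R j. (b i)\<^sup>2))
        + (\<Sum>j=1..n. \<Sum>i\<in>S. norm (restrict_c00 (E j) (restrict_c00 {t. \<pi> t = i} x)))"
    proof -
      have "(\<Sum>j=1..n. norm (restrict_c00 (E j) x)) \<le> (\<Sum>j=1..n. 2 * sqrt (\<Sum>i\<in>R j. (b i)\<^sup>2)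
          + (\<Sum>i\<in>S. norm (restrict_c00 (E j) (restrict_c00 {t. \<pi> t = i} x))))"
        by (rule sum_mono[OF piece])
      then show ?thesis by (simp only: sum.distrib sum_distrib_left)
    qed
    ultimately show "(\<Sum>j=1..n. norm (restrict_c00 (E j) x)) \<le> 2 * sqrt n * (2 * Q)"
      by linarith
  qed
  then have "(norm x)\<^sup>2 \<le> (2 * Q)\<^sup>2" by (intro power_mono) auto
  then show ?case by (simp add: power_mult_distrib Q2 b_def)
qed

section \<open>The lower estimate for flat blocks\<close>

definition splits :: "real \<Rightarrow> c00 \<Rightarrow> nat \<Rightarrow> bool" where
  "splits \<delta> x n \<longleftrightarrow> (\<exists>E. successive n E \<and> (\<forall>i\<in>{1..n}. \<delta> \<le> norm (restrict_c00 (E i) x)))"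

lemma splits_norm_ge:
  assumes "splits \<delta> x n" "0 \<le> \<delta>"
  shows "real n * \<delta>\<^sup>2 \<le> 4 * (norm x)\<^sup>2"
proof (cases "n = 0")
  case False
  obtain E where E: "successive n E" "\<And>i. i \<in> {1..n} \<Longrightarrow> \<delta> \<le> norm (restrict_c00 (E i) x)"
    using assms(1) by (auto simp: splits_def)
  have "real n * \<delta> = (\<Sum>i=1..n. \<delta>)" by simp
  also have "\<dots> \<le> (\<Sum>i=1..n. norm (restrict_c00 (E i) x))" by (rule sum_mono[OF E(2)])
  also have "\<dots> \<le> 2 * sqrt (real n) * norm x" by (rule sum_norm_restrict_le[OF E(1)])
  finally have "(real n * \<delta>)\<^sup>2 \<le> (2 * sqrt (real n) * norm x)\<^sup>2"
    using assms(2) by (intro power_mono) auto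
  then have "real n * (real n * \<delta>\<^sup>2) \<le> real n * (4 * (norm x)\<^sup>2)"
    by (simp add: power_mult_distrib) (simp add: power2_eq_square mult_ac)
  with False show ?thesis by (simp add: mult_le_cancel_left_pos)
qed simp

lemma splits_add:
  assumes AB: "set_less A B" and A: "splits \<delta> (restrict_c00 A x) m" and B: "splits \<delta> (restrict_c00 B x) n"
  shows "splits \<delta> x (m + n)"
proof -
  obtain E where E: "successive m E"
      "\<And>i. i \<in> {1..m} \<Longrightarrow> \<delta> \<le> norm (restrict_c00 (E i) (restrict_c00 A x))"
    using A by (auto simp: splits_def)
  obtain F where F: "successive n F"
      "\<And>i. i \<in> {1..n} \<Longrightarrow> \<delta> \<le> norm (restrict_c00 (F i) (restrict_c00 B x))"
    using B by (auto simp: splits_def)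
  define G where "G i = (if i \<le> m then E i \<inter> A else F (i - m) \<inter> B)" for i
  have "set_less (G i) (G j)" if ij: "i \<in> {1..m + n}" "j \<in> {1..m + n}" "i < j" for i j
  proof -
    consider "j \<le> m" | "i \<le> m" "m < j" | "m < i" by linarith
    then show ?thesis
    proof cases
      case 1
      then have "set_less (E i) (E j)" using E(1) ij by (auto simp: successive_def)
      with 1 ij show ?thesis by (auto simp: G_def set_less_def)
    next
      case 2
      with AB show ?thesis by (auto simp: G_def set_less_def)
    next
      case 3
      then have "i - m \<in> {1..n}" "j - m \<in> {1..n}" "i - m < j - m" using ij by auto
      then have "set_less (F (i - m)) (F (j - m))" using F(1) unfolding successive_def by blast
      with 3 ij show ?thesis by (auto simp: G_def set_less_def)
    qed
  qed
  then have "successive (m + n) G" by (simp add: successive_def)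
  moreover have "\<delta> \<le> norm (restrict_c00 (G i) x)" if "i \<in> {1..m + n}" for i
  proof (cases "i \<le> m")
    case True
    with E(2)[of i] that show ?thesis by (simp add: G_def)
  next
    case False
    then have "i - m \<in> {1..n}" using that by auto
    from F(2)[OF this] False show ?thesis by (simp add: G_def)
  qed
  ultimately show ?thesis unfolding splits_def by blast
qed

text \<open>
  Move the right end of an interval to the right one coordinate at a time and cut when the norm
  first exceeds \<open>\<delta>\<close>. A single coordinate adds at most \<open>\<delta>\<close>, so each completed piece has
  norm at most \<open>2 \<delta>\<close>. The last fibre \<open>n\<close> is the remainder.
\<close>
lemma exists_greedy_splitting:
  assumes "0 < \<delta>" "sup_norm x \<le> \<delta>"
  obtains \<pi> :: "nat \<Rightarrow> nat" and n where "mono \<pi>" "\<And>t. \<pi> t \<le> n"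
    "\<And>i. i < n \<Longrightarrow> norm (restrict_c00 {t. \<pi> t = i} x) \<in> {\<delta>..2 * \<delta>}"
    "norm (restrict_c00 {t. \<pi> t = n} x) \<le> \<delta>"
proof -
  have "\<exists>(\<pi>::nat \<Rightarrow> nat) n. mono \<pi> \<and> (\<forall>t. \<pi> t \<le> n) \<and> (\<forall>t\<ge>N. \<pi> t = n) \<and>
      (\<forall>i<n. norm (restrict_c00 {t. \<pi> t = i} x) \<in> {\<delta>..2 * \<delta>}) \<and>
      norm (restrict_c00 {t. \<pi> t = n \<and> t < N} x) \<le> \<delta>" for N
  proof (induction N)
    case 0
    then show ?case using assms(1) by (intro exI[of _ "\<lambda>_. 0"] exI[of _ 0]) (auto simp: mono_def)
  next
    case (Suc N)
    then obtain \<pi> :: "nat \<Rightarrow> nat" and n where \<pi>: "mono \<pi>" "\<And>t. \<pi> t \<le> n" "\<And>t. N \<le> t \<Longrightarrow> \<pi> t = n"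
      and old: "\<And>i. i < n \<Longrightarrow> norm (restrict_c00 {t. \<pi> t = i} x) \<in> {\<delta>..2 * \<delta>}"
      and last: "norm (restrict_c00 {t. \<pi> t = n \<and> t < N} x) \<le> \<delta>"
      by blast
    show ?case
    proof (cases "norm (restrict_c00 {t. \<pi> t = n \<and> t < Suc N} x) \<le> \<delta>")
      case True
      with \<pi> old show ?thesis by (intro exI[of _ \<pi>] exI[of _ n]) auto
    next
      case False
      have "restrict_c00 {t. \<pi> t = n \<and> t < Suc N} x
          = restrict_c00 {t. \<pi> t = n \<and> t < N} x + coord x N *\<^sub>R unit_vec N"
        using \<pi>(3)[of N] by (intro c00_eqI) (auto simp: coord_unit_vec less_Suc_eq)
      then have "norm (restrict_c00 {t. \<pi> t = n \<and> t < Suc N} x) \<le> \<delta> + \<bar>coord x N\<bar>"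
        using last norm_triangle_ineq[of "restrict_c00 {t. \<pi> t = n \<and> t < N} x" "coord x N *\<^sub>R unit_vec N"]
        by (simp add: norm_unit_vec)
      also have "\<dots> \<le> 2 * \<delta>" using coord_le_sup_norm[of x N] assms(2) by simp
      finally have new: "norm (restrict_c00 {t. \<pi> t = n \<and> t < Suc N} x) \<in> {\<delta>..2 * \<delta>}"
        using False by simp
      define \<pi>' where "\<pi>' t = (if t < Suc N then \<pi> t else Suc n)" for t
      have eq: "{t. \<pi>' t = i} = {t. \<pi> t = i}" if "i < n" for i
      proof -
        have "\<pi> t = n" if "\<not> t < Suc N" for t using \<pi>(3)[of t] that by simp
        with that show ?thesis by (auto simp: \<pi>'_def)
      qed
      have eq': "{t. \<pi>' t = n} = {t. \<pi> t = n \<and> t < Suc N}" by (auto simp: \<pi>'_def)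
      have "mono \<pi>'"
        using \<pi>(1,2) by (auto simp: \<pi>'_def mono_def le_SucI)
      moreover have "\<pi>' t \<le> Suc n" for t using \<pi>(2)[of t] by (auto simp: \<pi>'_def)
      moreover have "norm (restrict_c00 {t. \<pi>' t = i} x) \<in> {\<delta>..2 * \<delta>}" if "i < Suc n" for i
        using that old eq eq' new by (cases "i = n") auto
      moreover have "norm (restrict_c00 {t. \<pi>' t = Suc n \<and> t < Suc N} x) \<le> \<delta>"
      proof -
        have "\<pi> t \<noteq> Suc n" for t using \<pi>(2)[of t] by simp
        then have empty: "{t. \<pi>' t = Suc n \<and> t < Suc N} = {}" by (auto simp: \<pi>'_def)
        show ?thesis unfolding empty using assms(1) by simp
      qed
      moreover have "\<pi>' t = Suc n" if "Suc N \<le> t" for t using that by (simp add: \<pi>'_def)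
      ultimately show ?thesis using assms(1)
        by (intro exI[of _ \<pi>'] exI[of _ "Suc n"] conjI) auto
    qed
  qed
  from this[of "Suc (Max (supp x))"] obtain \<pi> :: "nat \<Rightarrow> nat" and n where
    \<pi>: "mono \<pi>" "\<And>t. \<pi> t \<le> n" "\<And>i. i < n \<Longrightarrow> norm (restrict_c00 {t. \<pi> t = i} x) \<in> {\<delta>..2 * \<delta>}"
    and last: "norm (restrict_c00 {t. \<pi> t = n \<and> t < Suc (Max (supp x))} x) \<le> \<delta>"
    by blast
  have "restrict_c00 {t. \<pi> t = n \<and> t < Suc (Max (supp x))} x = restrict_c00 {t. \<pi> t = n} x"
    by (intro restrict_c00_cong) (auto simp: less_Suc_eq_le)
  with last have "norm (restrict_c00 {t. \<pi> t = n} x) \<le> \<delta>" by simp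
  with \<pi> show thesis using that by blast
qed

text \<open>
  Many pieces are needed: by the upper estimate, \<open>n\<close> pieces of norm at most \<open>2 \<delta>\<close> and a remainder
  of norm at most \<open>\<delta>\<close> give a vector of squared norm at most \<open>4 (n (2 \<delta>)\<^sup>2 + \<delta>\<^sup>2)\<close>.
\<close>
lemma exists_splits_of_flat:
  assumes "0 < \<delta>" "sup_norm x \<le> \<delta>"
  obtains n where "splits \<delta> x n" "(norm x)\<^sup>2 \<le> 16 * \<delta>\<^sup>2 * real n + 4 * \<delta>\<^sup>2"
proof -
  obtain \<pi> :: "nat \<Rightarrow> nat" and n where \<pi>: "mono \<pi>" "\<And>t. \<pi> t \<le> n"
    and mid: "\<And>i. i < n \<Longrightarrow> norm (restrict_c00 {t. \<pi> t = i} x) \<in> {\<delta>..2 * \<delta>}"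
    and last: "norm (restrict_c00 {t. \<pi> t = n} x) \<le> \<delta>"
    using exists_greedy_splitting[OF assms] by blast
  have "successive n (\<lambda>i. {t. \<pi> t = i - 1})"
    unfolding successive_def set_less_def
  proof (intro ballI impI)
    fix i j a b :: nat
    assume h: "i \<in> {1..n}" "j \<in> {1..n}" "i < j" "a \<in> {t. \<pi> t = i - 1}" "b \<in> {t. \<pi> t = j - 1}"
    have "\<not> b \<le> a"
    proof
      assume "b \<le> a"
      from monoD[OF \<pi>(1) this] h show False by auto
    qed
    then show "a < b" by simp
  qed
  then have "splits \<delta> x n" unfolding splits_def using mid by (intro exI conjI) auto
  moreover have "(norm x)\<^sup>2 \<le> 4 * (\<Sum>i\<in>{..n}. (norm (restrict_c00 {t. \<pi> t = i} x))\<^sup>2)"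
    by (rule norm_sq_le_blocks) (use \<pi> in auto)
  moreover have "(\<Sum>i\<in>{..n}. (norm (restrict_c00 {t. \<pi> t = i} x))\<^sup>2) \<le> real n * (2 * \<delta>)\<^sup>2 + \<delta>\<^sup>2"
  proof -
    have "(\<Sum>i<n. (norm (restrict_c00 {t. \<pi> t = i} x))\<^sup>2) \<le> (\<Sum>i<n. (2 * \<delta>)\<^sup>2)"
      using mid by (intro sum_mono power_mono) auto
    moreover have "(norm (restrict_c00 {t. \<pi> t = n} x))\<^sup>2 \<le> \<delta>\<^sup>2"
      using last by (intro power_mono) auto
    ultimately show ?thesis by (simp add: lessThan_Suc_atMost[symmetric])
  qed
  ultimately show thesis using that[of n] by (simp add: power_mult_distrib algebra_simps)
qed

text \<open>
  The hypothesis \<open>large\<close> lets the term \<open>4 \<delta>\<^sup>2\<close> of the remainder be absorbed, so that \<open>x i\<close> splits into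
  at least \<open>\<parallel>x i\<parallel>\<^sup>2 / (32 \<delta>\<^sup>2)\<close> pieces. The pieces of all blocks form one successive family,
  to which the defining inequality of the norm is applied once.
\<close>
lemma flat_blocks_lower_l2:
  assumes M: "mono M" and supp: "\<And>i. i < m \<Longrightarrow> supp (x i) \<subseteq> {M i..<M (Suc i)}"
    and \<delta>: "0 < \<delta>" and flat: "\<And>i. i < m \<Longrightarrow> sup_norm (x i) \<le> \<delta>"
    and large: "\<And>i. i < m \<Longrightarrow> 8 * \<delta>\<^sup>2 \<le> (norm (x i))\<^sup>2"
  shows "(\<Sum>i<m. (norm (x i))\<^sup>2) \<le> 128 * (norm (\<Sum>i<m. x i))\<^sup>2"
proof -
  have "\<exists>n. splits \<delta> (\<Sum>i<k. x i) n \<and> (\<Sum>i<k. (norm (x i))\<^sup>2) \<le> 32 * \<delta>\<^sup>2 * real n" if "k \<le> m" for k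
    using that
  proof (induction k)
    case 0
    show ?case by (intro exI[of _ 0]) (auto simp: splits_def successive_def)
  next
    case (Suc k)
    then obtain n where n: "splits \<delta> (\<Sum>i<k. x i) n" "(\<Sum>i<k. (norm (x i))\<^sup>2) \<le> 32 * \<delta>\<^sup>2 * real n"
      by auto
    have k: "k < m" using Suc.prems by simp
    obtain n' where n': "splits \<delta> (x k) n'" "(norm (x k))\<^sup>2 \<le> 16 * \<delta>\<^sup>2 * real n' + 4 * \<delta>\<^sup>2"
      using exists_splits_of_flat[OF \<delta> flat[OF k]] .
    have zero: "coord (x i) t = 0" if "i < m" "t \<notin> {M i..<M (Suc i)}" for i t
      using supp[OF that(1)] that(2) by (auto simp: supp_def)
    have earlier: "coord (\<Sum>i<k. x i) t = 0" if "M k \<le> t" for t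
      unfolding coord_sum
    proof (intro sum.neutral ballI zero)
      fix i assume i: "i \<in> {..<k}"
      then have "M (Suc i) \<le> M k" by (intro monoD[OF M]) simp
      with that show "t \<notin> {M i..<M (Suc i)}" by simp
      show "i < m" using i k by simp
    qed
    have "restrict_c00 {..<M k} (\<Sum>i<Suc k. x i) = (\<Sum>i<k. x i)"
    proof (rule c00_eqI)
      fix t
      show "coord (restrict_c00 {..<M k} (\<Sum>i<Suc k. x i)) t = coord (\<Sum>i<k. x i) t"
        using zero[OF k, of t] earlier[of t] by auto
    qed
    moreover have "restrict_c00 {M k..} (\<Sum>i<Suc k. x i) = x k"
    proof (rule c00_eqI)
      fix t
      show "coord (restrict_c00 {M k..} (\<Sum>i<Suc k. x i)) t = coord (x k) t"
        using zero[OF k, of t] earlier[of t] by auto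
    qed
    moreover have "set_less {..<M k} {M k..}" by (auto simp: set_less_def)
    ultimately have "splits \<delta> (\<Sum>i<Suc k. x i) (n + n')"
      using n(1) n'(1) by (intro splits_add[of "{..<M k}" "{M k..}"]) simp_all
    moreover have "(norm (x k))\<^sup>2 \<le> 32 * \<delta>\<^sup>2 * real n'" using n'(2) large[OF k] by simp
    ultimately show ?case using n(2) by (intro exI[of _ "n + n'"]) (simp add: algebra_simps)
  qed
  then obtain n where n: "splits \<delta> (\<Sum>i<m. x i) n" "(\<Sum>i<m. (norm (x i))\<^sup>2) \<le> 32 * \<delta>\<^sup>2 * real n"
    by blast
  with splits_norm_ge[OF n(1)] \<delta> show ?thesis by (simp add: mult_ac)
qed

section \<open>The basis does not dominate the Hilbert space basis\<close>

definition fin_vec :: "(nat \<Rightarrow> real) \<Rightarrow> nat set \<Rightarrow> c00" where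
  "fin_vec f E = (\<Sum>t\<in>E. f t *\<^sub>R unit_vec t)"

lemma coord_fin_vec: "finite E \<Longrightarrow> coord (fin_vec f E) t = (if t \<in> E then f t else 0)"
  by (simp add: fin_vec_def coord_sum coord_unit_vec if_distrib cong: if_cong)

lemma supp_fin_vec: "finite E \<Longrightarrow> supp (fin_vec f E) \<subseteq> E"
  by (auto simp: supp_def coord_fin_vec split: if_splits)

definition interval_hull :: "nat set \<Rightarrow> nat set" where
  "interval_hull E = {t. \<exists>a\<in>E. \<exists>b\<in>E. a \<le> t \<and> t \<le> b}"

lemma interval_hull_eq: "finite E \<Longrightarrow> E \<noteq> {} \<Longrightarrow> interval_hull E = {Min E..Max E}"
  unfolding interval_hull_def atLeastAtMost_def atLeast_def atMost_def
  by (auto simp: Min_le_iff Max_ge_iff)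

lemma finite_interval_hull: "finite E \<Longrightarrow> finite (interval_hull E)"
  by (cases "E = {}") (simp_all add: interval_hull_eq, simp add: interval_hull_def)

lemma sum_card_interval_hull_le:
  assumes E: "finite E" and F: "successive n F"
  shows "(\<Sum>k=1..n. card (interval_hull (E \<inter> F k))) \<le> card (interval_hull E)"
proof -
  have disj: "interval_hull (E \<inter> F k) \<inter> interval_hull (E \<inter> F l) = {}"
    if "k \<in> {1..n}" "l \<in> {1..n}" "k < l" for k l
  proof (rule ccontr)
    assume "\<not> ?thesis"
    then obtain t b a where "b \<in> F k" "t \<le> b" "a \<in> F l" "a \<le> t" by (auto simp: interval_hull_def)
    moreover have "set_less (F k) (F l)" using F that by (simp add: successive_def)
    ultimately show False by (force simp: set_less_def)
  qed
  have "(\<Sum>k=1..n. card (interval_hull (E \<inter> F k))) = card (\<Union>k\<in>{1..n}. interval_hull (E \<inter> F k))"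
  proof (rule card_UN_disjoint[symmetric])
    show "\<forall>k\<in>{1..n}. \<forall>l\<in>{1..n}. k \<noteq> l \<longrightarrow>
        interval_hull (E \<inter> F k) \<inter> interval_hull (E \<inter> F l) = {}"
      using disj by (metis Int_commute linorder_neqE_nat)
  qed (use E in \<open>auto intro: finite_interval_hull\<close>)
  also have "\<dots> \<le> card (interval_hull E)"
    using E by (intro card_mono finite_interval_hull) (auto simp: interval_hull_def)
  finally show ?thesis .
qed

text \<open>
  The additive constant \<open>2\<close> is not optimal, but it makes the proof a comparison of two floors.
\<close>
lemma card_multiples_le:
  assumes "finite E" "0 < d"
  shows "real (card {t\<in>E. d dvd t}) \<le> real (card (interval_hull E)) / real d + 2"
proof (cases "E = {}")
  case False
  define a b where "a = Min E" and "b = Max E"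
  have ab: "a \<le> b" using assms False by (simp add: a_def b_def)
  have "card {t\<in>E. d dvd t} \<le> card {a div d..b div d}"
  proof (rule card_inj_on_le[where f = "\<lambda>t. t div d"])
    show "inj_on (\<lambda>t. t div d) {t\<in>E. d dvd t}" by (rule inj_onI) (auto simp: dvd_def)
    show "(\<lambda>t. t div d) ` {t\<in>E. d dvd t} \<subseteq> {a div d..b div d}"
      using assms by (auto simp: a_def b_def div_le_mono)
  qed simp
  then have "real (card {t\<in>E. d dvd t}) \<le> real (b div d) + 1 - real (a div d)"
    using ab div_le_mono[OF ab, of d] by simp
  moreover have "real (b div d) \<le> real b / real d" by (rule of_nat_div_le_of_nat)
  moreover have "real a / real d \<le> real (a div d) + 1"
  proof -
    have "a \<le> (a div d + 1) * d" using dividend_less_div_times[of d a] assms(2) by simp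
    then have "real a \<le> real ((a div d + 1) * d)" by (simp only: of_nat_le_iff)
    then show ?thesis using assms(2) by (simp add: divide_le_eq distrib_right add.commute)
  qed
  moreover have "card (interval_hull E) = Suc b - a"
    using assms False by (simp add: interval_hull_eq a_def b_def)
  then have "real b - real a \<le> real (card (interval_hull E))" using ab by simp
  then have "(real b - real a) / real d \<le> real (card (interval_hull E)) / real d"
    by (rule divide_right_mono) simp
  ultimately show ?thesis by (simp add: diff_divide_distrib)
qed (simp add: assms)

text \<open>
  The name recalls the marks of a ruler: the higher the power of \<open>4\<close> dividing \<open>t\<close>, the longer the
  mark. The layer \<open>j\<close> has height \<open>2\<^sup>j\<close> and density \<open>4\<^sup>-\<^sup>j\<close>, so all layers have the same
  \<open>\<ell>\<^sub>2\<close> norm on long intervals.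
\<close>
definition ruler :: "nat \<Rightarrow> nat \<Rightarrow> real" where
  "ruler J t = (\<Sum>j<J. if 4 ^ j dvd t then 2 ^ j else 0)"

lemma sum_pow2_le: "(\<Sum>j<J. 2 ^ j) \<le> (2 ^ J :: real)"
  by (induction J) auto

lemma sum_half_pow_le: "(\<Sum>j=i..<J. (1/2) ^ j) \<le> 2 * (1/2 :: real) ^ i"
proof -
  have "(\<Sum>j=i..<J. (1/2) ^ j) \<le> 2 * (1/2 :: real) ^ i - 2 * (1/2) ^ J" if "i \<le> J"
    using that by (induction J rule: dec_induct) auto
  moreover have "(0::real) \<le> (1/2) ^ J" "(0::real) \<le> (1/2) ^ i" by auto
  ultimately show ?thesis
    by (cases "i \<le> J") (linarith, simp)
qed

lemma ruler_nonneg: "0 \<le> ruler J t"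
  by (auto simp: ruler_def intro: sum_nonneg)

lemma ruler_le: "ruler J t \<le> 2 ^ J"
  unfolding ruler_def by (rule order_trans[OF sum_mono sum_pow2_le]) auto

text \<open>
  The bound does not deteriorate with the number \<open>J\<close> of layers, except for the peak height \<open>2\<^sup>J\<close>. Let
  \<open>L\<close> be the length of the hull of \<open>E\<close>, and let \<open>F\<^sub>1 < \<dots> < F\<^sub>n\<close>. The layers \<open>j\<close> with
  \<open>L \<le> n 4\<^sup>j\<close> are sparse relative to \<open>n\<close>, so their total \<open>\<ell>\<^sub>1\<close> norm is at most
  \<open>2 \<surd>n \<surd>L + 2 \<cdot> 2\<^sup>J\<close>. The other layers form a ruler with lower peaks, to which the
  induction hypothesis applies on every \<open>F\<^sub>k\<close>. Summing with Cauchy-Schwarz gives at most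
  \<open>4 \<surd>n \<surd>L\<close>, plus \<open>2 \<surd>n \<surd>L\<close> from the peaks. Together this is
  \<open>8 \<surd>n \<surd>L + 2 \<cdot> 2\<^sup>J\<close>, and division by \<open>2 \<surd>n\<close> returns the bound.
\<close>
lemma norm_ruler_le:
  assumes "finite E"
  shows "norm (fin_vec (ruler J) E) \<le> 4 * sqrt (real (card (interval_hull E))) + 2 ^ J"
  using assms
proof (induction "card E" arbitrary: E J rule: less_induct)
  case less
  note fin = less.prems
  define L where "L = card (interval_hull E)"
  show ?case
    unfolding L_def[symmetric]
  proof (rule norm_c00_leI[OF supp_fin_vec[OF fin]])
    show "sup_norm (fin_vec (ruler J) E) \<le> 4 * sqrt (real L) + 2 ^ J"
    proof (rule sup_norm_leI)
      fix t
      have "\<bar>coord (fin_vec (ruler J) E) t\<bar> \<le> 2 ^ J"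
        using ruler_nonneg[of J t] ruler_le[of J t] by (simp add: coord_fin_vec fin)
      then show "\<bar>coord (fin_vec (ruler J) E) t\<bar> \<le> 4 * sqrt (real L) + 2 ^ J"
        by (simp add: add_increasing)
    qed
    fix n F assume n: "1 \<le> n" "successive n F" and proper: "\<And>k. k \<in> {1..n} \<Longrightarrow> \<not> E \<subseteq> F k"
    \<comment> \<open>Layers \<open>j < j1\<close> are dense and layers \<open>j1 \<le> j < J\<close> are sparse relative to \<open>n\<close>.\<close>
    define j0 where "j0 = (LEAST j. L \<le> n * 4 ^ j)"
    define j1 where "j1 = min j0 J"
    have "L < 2 ^ L" by (rule less_exp)
    also have "(2::nat) ^ L \<le> 4 ^ L" by (rule power_mono) auto
    also have "\<dots> \<le> n * 4 ^ L" using n(1) by simp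
    finally have j0: "L \<le> n * 4 ^ j0"
      using LeastI[of "\<lambda>j. L \<le> n * 4 ^ j" L] by (simp add: j0_def)
    have below_j0: "n * 4 ^ j < L" if "j < j0" for j
      using not_less_Least[of j "\<lambda>j. L \<le> n * 4 ^ j"] that by (simp add: j0_def)
    define head where "head t = (\<Sum>j=j1..<J. if 4 ^ j dvd t then 2 ^ j else (0::real))" for t :: nat
    have head0: "0 \<le> head t" for t by (auto simp: head_def intro: sum_nonneg)
    have ruler_split: "ruler J t = ruler j1 t + head t" for t
      unfolding ruler_def head_def lessThan_atLeast0
      by (rule sum.atLeastLessThan_concat[symmetric]) (auto simp: j1_def)
    have tail: "(\<Sum>k=1..n. norm (fin_vec (ruler j1) (E \<inter> F k))) \<le> 6 * (sqrt n * sqrt L)"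
    proof (cases j1)
      case 0
      then show ?thesis by (simp add: fin_vec_def ruler_def)
    next
      case (Suc j)
      have "(\<Sum>k=1..n. norm (fin_vec (ruler j1) (E \<inter> F k)))
          \<le> (\<Sum>k=1..n. 4 * sqrt (real (card (interval_hull (E \<inter> F k)))) + 2 ^ j1)"
      proof (rule sum_mono)
        fix k assume "k \<in> {1..n}"
        then show "norm (fin_vec (ruler j1) (E \<inter> F k))
            \<le> 4 * sqrt (real (card (interval_hull (E \<inter> F k)))) + 2 ^ j1"
          using proper[of k] fin by (intro less.hyps psubset_card_mono) auto
      qed
      also have "\<dots> = 4 * (\<Sum>k=1..n. sqrt (real (card (interval_hull (E \<inter> F k))))) + real n * 2 ^ j1"
        by (simp add: sum.distrib sum_distrib_left)
      also have "(\<Sum>k=1..n. sqrt (real (card (interval_hull (E \<inter> F k))))) \<le> sqrt n * sqrt L"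
      proof -
        have "(\<Sum>k=1..n. 1 * sqrt (real (card (interval_hull (E \<inter> F k)))))\<^sup>2
            \<le> (\<Sum>k=1..n. 1\<^sup>2) * (\<Sum>k=1..n. (sqrt (real (card (interval_hull (E \<inter> F k)))))\<^sup>2)"
          by (rule Cauchy_Schwarz_ineq_sum)
        also have "\<dots> = real (n * (\<Sum>k=1..n. card (interval_hull (E \<inter> F k))))" by simp
        also have "\<dots> \<le> real (n * L)"
          unfolding of_nat_le_iff L_def by (intro mult_left_mono sum_card_interval_hull_le fin n(2)) simp
        finally show ?thesis by (simp add: real_le_rsqrt real_sqrt_mult[symmetric])
      qed
      also have "real n * 2 ^ j1 \<le> 2 * (sqrt n * sqrt L)"
      proof -
        have "n * 4 ^ j < L" using Suc by (intro below_j0) (simp add: j1_def)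
        then have "n * (n * 4 ^ j) \<le> n * L" by (intro mult_left_mono) auto
        then have "real (n * (n * 4 ^ j)) \<le> real (n * L)" by (simp only: of_nat_le_iff)
        moreover have "real (n * (n * 4 ^ j)) = (real n * 2 ^ j)\<^sup>2"
          by (simp add: power2_eq_square power_mult_distrib[symmetric])
        ultimately have "real n * 2 ^ j \<le> sqrt (real n * real L)" by (intro real_le_rsqrt) simp
        then show ?thesis using Suc by (simp add: real_sqrt_mult)
      qed
      finally show ?thesis by linarith
    qed
    have "(\<Sum>k=1..n. norm (fin_vec head (E \<inter> F k))) \<le> 2 * (sqrt n * sqrt L) + 2 * 2 ^ J"
    proof -
      have "norm (fin_vec head (E \<inter> F k)) \<le> (\<Sum>t\<in>E \<inter> F k. head t)" for k
      proof -
        have fin': "finite (E \<inter> F k)" using fin by simp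
        from norm_le_sum_abs_coord[OF fin' supp_fin_vec[OF fin', of head]] show ?thesis
          using fin' head0 by (simp add: coord_fin_vec)
      qed
      then have "(\<Sum>k=1..n. norm (fin_vec head (E \<inter> F k))) \<le> (\<Sum>k=1..n. \<Sum>t\<in>E \<inter> F k. head t)"
        by (rule sum_mono)
      also have "\<dots> = (\<Sum>t\<in>(\<Union>k\<in>{1..n}. E \<inter> F k). head t)"
      proof (rule sum.UNION_disjoint[symmetric])
        show "\<forall>i\<in>{1..n}. \<forall>j\<in>{1..n}. i \<noteq> j \<longrightarrow> E \<inter> F i \<inter> (E \<inter> F j) = {}"
          using successive_disjoint[OF n(2)] by blast
      qed (use fin in auto)
      also have "\<dots> \<le> (\<Sum>t\<in>E. head t)" using fin head0 by (intro sum_mono2) auto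
      also have "\<dots> = (\<Sum>j=j1..<J. \<Sum>t\<in>E. if 4 ^ j dvd t then 2 ^ j else 0)"
        unfolding head_def by (rule sum.swap)
      also have "\<dots> = (\<Sum>j=j1..<J. 2 ^ j * real (card {t\<in>E. 4 ^ j dvd t}))"
        using fin by (intro sum.cong refl) (simp add: sum.If_cases Int_def mult.commute)
      also have "\<dots> \<le> (\<Sum>j=j1..<J. 2 ^ j * (real L / real (4 ^ j) + 2))"
        unfolding L_def using fin by (intro sum_mono mult_left_mono card_multiples_le) auto
      also have "\<dots> = (\<Sum>j=j1..<J. real L * (1/2) ^ j + 2 * 2 ^ j)"
      proof (intro sum.cong refl)
        fix j
        have "(4::real) ^ j = 2 ^ j * 2 ^ j" by (simp add: power_mult_distrib[symmetric])
        then show "2 ^ j * (real L / real (4 ^ j) + 2) = real L * (1/2) ^ j + 2 * 2 ^ j"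
          by (simp add: field_simps power_divide)
      qed
      also have "\<dots> = real L * (\<Sum>j=j1..<J. (1/2) ^ j) + 2 * (\<Sum>j=j1..<J. 2 ^ j)"
        by (simp add: sum.distrib sum_distrib_left)
      also have "real L * (\<Sum>j=j1..<J. (1/2) ^ j) \<le> 2 * (sqrt n * sqrt L)"
      proof (cases "j1 < J")
        case True
        then have "j1 = j0" by (simp add: j1_def)
        then have "L * L \<le> L * (n * 4 ^ j1)" using j0 by (intro mult_left_mono) auto
        then have "real (L * L) \<le> real (L * (n * 4 ^ j1))" by (simp only: of_nat_le_iff)
        moreover have "(4::real) ^ j1 = 2 ^ j1 * 2 ^ j1" by (simp add: power_mult_distrib[symmetric])
        ultimately have "(real L * (1/2) ^ j1)\<^sup>2 \<le> real n * real L"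
          by (simp add: power2_eq_square field_simps power_divide)
        then have "real L * (1/2) ^ j1 \<le> sqrt (real n * real L)" by (rule real_le_rsqrt)
        moreover have "real L * (\<Sum>j=j1..<J. (1/2) ^ j) \<le> real L * (2 * (1/2) ^ j1)"
          by (intro mult_left_mono sum_half_pow_le) simp
        ultimately show ?thesis by (simp add: real_sqrt_mult)
      qed simp
      also have "(\<Sum>j=j1..<J. 2 ^ j) \<le> (\<Sum>j<J. (2::real) ^ j)" by (rule sum_mono2) auto
      also note sum_pow2_le
      finally show ?thesis by simp
    qed
    moreover have "norm (restrict_c00 (F k) (fin_vec (ruler J) E))
        \<le> norm (fin_vec (ruler j1) (E \<inter> F k)) + norm (fin_vec head (E \<inter> F k))" for k
    proof -
      have "restrict_c00 (F k) (fin_vec (ruler J) E) = fin_vec (ruler j1) (E \<inter> F k) + fin_vec head (E \<inter> F k)"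
        using fin by (intro c00_eqI) (simp add: coord_fin_vec ruler_split)
      then show ?thesis by (simp add: norm_triangle_ineq)
    qed
    then have "(\<Sum>k=1..n. norm (restrict_c00 (F k) (fin_vec (ruler J) E)))
        \<le> (\<Sum>k=1..n. norm (fin_vec (ruler j1) (E \<inter> F k))) + (\<Sum>k=1..n. norm (fin_vec head (E \<inter> F k)))"
      unfolding sum.distrib[symmetric] by (rule sum_mono)
    moreover have "1 * 2 ^ J \<le> sqrt n * 2 ^ J" using n(1) by (intro mult_right_mono) auto
    moreover have "2 * sqrt n * (4 * sqrt L + 2 ^ J) = 8 * (sqrt n * sqrt L) + 2 * (sqrt n * 2 ^ J)"
      by (simp add: algebra_simps)
    ultimately show "(\<Sum>k=1..n. norm (restrict_c00 (F k) (fin_vec (ruler J) E)))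
        \<le> 2 * sqrt n * (4 * sqrt L + 2 ^ J)"
      using tail by linarith
  qed
qed

text \<open>
  The layers overlap, but their cross terms are nonnegative. Each of the \<open>K + 1\<close> layers contributes
  \<open>4\<^sup>j \<cdot> 4\<^sup>K\<^sup>-\<^sup>j\<close>.
\<close>
lemma ruler_sum_squares_ge:
  "real (Suc K) * 4 ^ K \<le> (\<Sum>t<4 ^ K. (ruler (Suc K) t)\<^sup>2)"
proof -
  define f :: "nat \<Rightarrow> nat \<Rightarrow> real" where "f t j = (if 4 ^ j dvd t then 2 ^ j else 0)" for t j
  have f0: "0 \<le> f t j" for t j by (simp add: f_def)
  have "(\<Sum>j<Suc K. (f t j)\<^sup>2) \<le> (ruler (Suc K) t)\<^sup>2" for t
  proof -
    have "(\<Sum>j<Suc K. (f t j)\<^sup>2) \<le> (\<Sum>j<Suc K. f t j * (\<Sum>i<Suc K. f t i))"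
      unfolding power2_eq_square using f0 by (intro sum_mono mult_left_mono member_le_sum) auto
    also have "\<dots> = (ruler (Suc K) t)\<^sup>2"
      unfolding sum_distrib_right[symmetric] ruler_def f_def by (simp add: power2_eq_square)
    finally show ?thesis .
  qed
  then have "(\<Sum>t<4 ^ K. (ruler (Suc K) t)\<^sup>2) \<ge> (\<Sum>t<4 ^ K. \<Sum>j<Suc K. (f t j)\<^sup>2)"
    by (rule sum_mono)
  moreover have "(\<Sum>t<4 ^ K. \<Sum>j<Suc K. (f t j)\<^sup>2) = (\<Sum>j<Suc K. \<Sum>t<4 ^ K. (f t j)\<^sup>2)"
    by (rule sum.swap)
  moreover have "(\<Sum>t<4 ^ K. (f t j)\<^sup>2) \<ge> 4 ^ K" if "j < Suc K" for j
  proof -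
    have "(4::nat) ^ (K - j) * 4 ^ j = 4 ^ K" using that by (simp add: power_add[symmetric])
    then have "(4::real) ^ K = real (4 ^ (K - j)) * 4 ^ j" by (metis of_nat_mult of_nat_numeral of_nat_power)
    also have "real (4 ^ (K - j)) = real (card ((\<lambda>q. 4 ^ j * q) ` {..<(4::nat) ^ (K - j)}))"
      by (subst card_image) (auto simp: inj_on_def)
    also have "\<dots> * 4 ^ j = (\<Sum>t\<in>(\<lambda>q. 4 ^ j * q) ` {..<4 ^ (K - j)}. (f t j)\<^sup>2)"
    proof -
      have "(2 ^ j)\<^sup>2 = (4::real) ^ j" by (simp add: power2_eq_square power_mult_distrib[symmetric])
      then have "(\<Sum>t\<in>(\<lambda>q. 4 ^ j * q) ` {..<4 ^ (K - j)}. (f t j)\<^sup>2)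
          = (\<Sum>t\<in>(\<lambda>q. 4 ^ j * q) ` {..<(4::nat) ^ (K - j)}. 4 ^ j)"
        by (intro sum.cong) (auto simp: f_def)
      then show ?thesis by simp
    qed
    also have "\<dots> \<le> (\<Sum>t<4 ^ K. (f t j)\<^sup>2)"
    proof (rule sum_mono2)
      show "(\<lambda>q. 4 ^ j * q) ` {..<4 ^ (K - j)} \<subseteq> {..<(4::nat) ^ K}"
      proof clarsimp
        fix q :: nat assume "q < 4 ^ (K - j)"
        then have "4 ^ j * q < 4 ^ j * 4 ^ (K - j)" by simp
        also have "\<dots> = 4 ^ K" using that by (simp add: power_add[symmetric])
        finally show "4 ^ j * q < 4 ^ K" .
      qed
    qed auto
    finally show ?thesis .
  qed
  then have "(\<Sum>j<Suc K. \<Sum>t<4 ^ K. (f t j)\<^sup>2) \<ge> (\<Sum>j<Suc K. 4 ^ K)" by (intro sum_mono) auto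
  ultimately show ?thesis by simp
qed

lemma norm_ruler_initial_le: "norm (fin_vec (ruler (Suc K)) {..<4 ^ K}) \<le> 6 * 2 ^ K"
proof -
  have "interval_hull {..<4 ^ K} \<subseteq> {..<4 ^ K}" by (auto simp: interval_hull_def)
  then have "card (interval_hull {..<4 ^ K}) \<le> 4 ^ K" by (metis card_lessThan card_mono finite_lessThan)
  then have "real (card (interval_hull {..<4 ^ K})) \<le> real (4 ^ K)" by (simp only: of_nat_le_iff)
  also have "\<dots> = (2 ^ K)\<^sup>2" by (simp add: power2_eq_square power_mult_distrib[symmetric])
  finally have "sqrt (real (card (interval_hull {..<4 ^ K}))) \<le> 2 ^ K" by (simp add: real_le_lsqrt)
  with norm_ruler_le[of "{..<4 ^ K}" "Suc K"] show ?thesis by simp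
qed

section \<open>A subspace of flat vectors\<close>

lemma independent_unit_vec: "independent (range unit_vec)"
  unfolding independent_explicit_module
proof (intro allI impI)
  fix t u v
  assume t: "finite t" "t \<subseteq> range unit_vec" "(\<Sum>w\<in>t. u w *\<^sub>R w) = 0" "v \<in> t"
  then obtain k where k: "v = unit_vec k" by blast
  have "coord w k = (if w = v then 1 else 0)" if "w \<in> t" for w
    using t(2) that k by (auto simp: coord_unit_vec)
  then have eq: "(\<Sum>w\<in>t. coord (u w *\<^sub>R w) k) = (\<Sum>w\<in>t. if w = v then u w else 0)"
    by (intro sum.cong) auto
  have "0 = coord (\<Sum>w\<in>t. u w *\<^sub>R w) k" using t(3) by simp
  also have "\<dots> = u v" unfolding coord_sum eq using t(1,4) by simp
  finally show "u v = 0" by simp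
qed

lemma inj_unit_vec: "inj unit_vec"
  by (rule injI) (metis coord_unit_vec zero_neq_one)

text \<open>
  Repeats the \<open>k\<close>-th coordinate on the interval \<open>[k\<^sup>2, (k+1)\<^sup>2)\<close>. What matters is that the
  intervals are finite and that their lengths \<open>2 k + 1\<close> tend to infinity.
\<close>
lift_definition stretch :: "c00 \<Rightarrow> c00" is "\<lambda>x t. x (floor_sqrt t)"
proof -
  fix x :: "nat \<Rightarrow> real" assume "finite {i. x i \<noteq> 0}"
  then have "finite (\<Union>k\<in>{i. x i \<noteq> 0}. {..<(Suc k)\<^sup>2})" by auto
  moreover have "{t. x (floor_sqrt t) \<noteq> 0} \<subseteq> (\<Union>k\<in>{i. x i \<noteq> 0}. {..<(Suc k)\<^sup>2})"
    using Suc_floor_sqrt_power2_gt by auto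
  ultimately show "finite {t. x (floor_sqrt t) \<noteq> 0}" by (rule finite_subset[rotated])
qed

lemma coord_stretch: "coord (stretch x) t = coord x (floor_sqrt t)"
  by (simp add: stretch.rep_eq)

lemma linear_stretch: "linear stretch"
  by (rule linearI; rule c00_eqI) (simp_all add: coord_stretch)

lemma inj_stretch: "inj stretch"
proof (rule injI, rule c00_eqI)
  fix x y k assume "stretch x = stretch y"
  then have "coord (stretch x) (k\<^sup>2) = coord (stretch y) (k\<^sup>2)" by simp
  then show "coord x k = coord y k" by (simp add: coord_stretch)
qed

text \<open>
  The singletons of the interval around \<open>t\<close> are \<open>2 k + 1\<close> successive sets on which the vector has the
  same absolute value.
\<close>
lemma abs_coord_stretch_le:
  "\<bar>coord (stretch x) t\<bar> \<le> 2 / sqrt (real (2 * floor_sqrt t + 1)) * norm (stretch x)"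
proof -
  define k where "k = floor_sqrt t"
  define D where "D = {k\<^sup>2..<(Suc k)\<^sup>2}"
  have card: "card D = 2 * k + 1" by (simp add: D_def power2_eq_square)
  have k: "floor_sqrt s = k" if "s \<in> D" for s using that by (intro floor_sqrt_unique) (auto simp: D_def)
  have "(\<Sum>s\<in>D. norm (restrict_c00 {s} (stretch x))) \<le> 2 * sqrt (real (card D)) * norm (stretch x)"
    by (rule sum_norm_restrict_le_card) (auto simp: D_def set_less_def)
  also have "(\<Sum>s\<in>D. norm (restrict_c00 {s} (stretch x))) = (\<Sum>s\<in>D. \<bar>coord x k\<bar>)"
    by (intro sum.cong) (simp_all add: restrict_c00_singleton norm_unit_vec coord_stretch k)
  also have "\<dots> = sqrt (real (2 * k + 1)) * (sqrt (real (2 * k + 1)) * \<bar>coord x k\<bar>)"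
    by (simp add: card mult.assoc[symmetric] del: of_nat_add of_nat_Suc)
  finally have "sqrt (real (2 * k + 1)) * (sqrt (real (2 * k + 1)) * \<bar>coord x k\<bar>)
      \<le> sqrt (real (2 * k + 1)) * (2 * norm (stretch x))"
    unfolding card by (simp only: mult_ac)
  moreover have pos: "0 < sqrt (real (2 * k + 1))" by simp
  ultimately have "sqrt (real (2 * k + 1)) * \<bar>coord x k\<bar> \<le> 2 * norm (stretch x)"
    by (simp only: mult_le_cancel_left_pos)
  then have "\<bar>coord x k\<bar> \<le> (2 * norm (stretch x)) / sqrt (real (2 * k + 1))"
    by (subst pos_le_divide_eq[OF pos]) (simp only: mult.commute)
  then show ?thesis by (simp add: coord_stretch k_def[symmetric])
qed

lemma infinite_dimensional_closure_stretch:
  "infinite_dimensional (closure (completion_embed ` range stretch) :: ti_space set)"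
proof -
  define h where "h = completion_embed \<circ> stretch"
  have lin: "linear h" unfolding h_def by (rule linear_compose[OF linear_stretch linear_completion_embed])
  have "inj (completion_embed :: c00 \<Rightarrow> ti_space)"
    unfolding linear_injective_0[OF linear_completion_embed]
    by (metis norm_completion_embed norm_eq_zero)
  then have inj: "inj h" unfolding h_def using inj_stretch by (rule inj_compose)
  have "independent (h ` range unit_vec)"
    using linear_independent_injective_image[OF lin independent_unit_vec] inj
    by (metis inj_on_subset subset_UNIV)
  moreover have "infinite (h ` range unit_vec)"
    using inj inj_unit_vec by (metis finite_imageD infinite_UNIV_nat inj_on_subset subset_UNIV)
  moreover have "h ` range unit_vec \<subseteq> closure (completion_embed ` range stretch)"
    using closure_subset by (fastforce simp: h_def)
  ultimately have not_sub: "\<not> closure (completion_embed ` range stretch) \<subseteq> span D"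
    if "finite D" for D :: "ti_space set"
    using real_vector.independent_span_bound[OF that, of "h ` range unit_vec"] by (meson order_trans)
  then show ?thesis unfolding infinite_dimensional_def by (simp only: not_ex de_Morgan_conj) (rule allI, blast)
qed

text \<open>
  A compactness argument: beyond some \<open>R\<close> all coordinates are below \<open>\<epsilon> / 2\<close>, and on the
  first \<open>R\<close> coordinates some subsequence converges.
\<close>
lemma exists_small_difference:
  fixes z :: "nat \<Rightarrow> c00"
  assumes flat: "\<And>i t. \<bar>coord (z i) t\<bar> \<le> \<theta> t" and \<theta>: "\<theta> \<longlonglongrightarrow> 0" and "0 < \<epsilon>"
  obtains p q where "N \<le> p" "p < q" "sup_norm (z p - z q) \<le> \<epsilon>"
proof -
  have "\<forall>\<^sub>F t in sequentially. \<theta> t < \<epsilon> / 2" using \<theta> \<open>0 < \<epsilon>\<close> by (intro order_tendstoD) auto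
  then obtain R where R: "\<And>t. R \<le> t \<Longrightarrow> \<theta> t < \<epsilon> / 2" by (auto simp: eventually_sequentially)
  have "\<exists>r::nat \<Rightarrow> nat. strict_mono r \<and> (\<forall>t<R. convergent (\<lambda>i. coord (z (r i)) t))" for R
  proof (induction R)
    case 0
    show ?case by (rule exI[of _ id]) (simp add: strict_mono_def)
  next
    case (Suc R)
    then obtain r :: "nat \<Rightarrow> nat" where r: "strict_mono r"
      "\<And>t. t < R \<Longrightarrow> convergent (\<lambda>i. coord (z (r i)) t)" by blast
    have "bounded (range (\<lambda>i. coord (z (r i)) R))"
      unfolding bounded_iff using flat by (intro exI[of _ "\<theta> R"]) auto
    then obtain l s where s: "strict_mono s" "((\<lambda>i. coord (z (r i)) R) \<circ> s) \<longlonglongrightarrow> l"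
      using bounded_imp_convergent_subsequence by blast
    have "convergent (\<lambda>i. coord (z ((r \<circ> s) i)) t)" if "t < Suc R" for t
    proof (cases "t = R")
      case True
      with s(2) show ?thesis by (auto simp: convergent_def o_def)
    next
      case False
      with that r(2)[of t] have "convergent (\<lambda>i. coord (z (r i)) t)" by simp
      from convergent_subseq_convergent[OF this s(1)] show ?thesis by (simp add: o_def)
    qed
    moreover have "strict_mono (r \<circ> s)" using r(1) s(1) by (rule strict_mono_o)
    ultimately show ?case by blast
  qed
  from this[of R] obtain r :: "nat \<Rightarrow> nat" where r: "strict_mono r"
    and conv: "\<And>t. t < R \<Longrightarrow> convergent (\<lambda>i. coord (z (r i)) t)" by blast
  define l where "l t = lim (\<lambda>i. coord (z (r i)) t)" for t
  have "\<forall>\<^sub>F i in sequentially. \<forall>t\<in>{..<R}. dist (coord (z (r i)) t) (l t) < \<epsilon> / 2"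
  proof (rule eventually_ball_finite)
    show "\<forall>t\<in>{..<R}. \<forall>\<^sub>F i in sequentially. dist (coord (z (r i)) t) (l t) < \<epsilon> / 2"
    proof
      fix t assume "t \<in> {..<R}"
      then have "(\<lambda>i. coord (z (r i)) t) \<longlonglongrightarrow> l t"
        unfolding l_def using conv by (simp add: convergent_LIMSEQ_iff[symmetric])
      then show "\<forall>\<^sub>F i in sequentially. dist (coord (z (r i)) t) (l t) < \<epsilon> / 2"
        using \<open>0 < \<epsilon>\<close> by (intro tendstoD) auto
    qed
  qed simp
  then obtain N' where N': "\<And>i t. N' \<le> i \<Longrightarrow> t < R \<Longrightarrow> dist (coord (z (r i)) t) (l t) < \<epsilon> / 2"
    by (auto simp: eventually_sequentially)
  define i where "i = max N N'"
  have i: "N \<le> i" "N' \<le> i" by (simp_all add: i_def)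
  show thesis
  proof (rule that)
    show "N \<le> r i" using seq_suble[OF r, of i] i(1) by linarith
    show "r i < r (Suc i)" using r by (simp add: strict_mono_less)
    show "sup_norm (z (r i) - z (r (Suc i))) \<le> \<epsilon>"
    proof (rule sup_norm_leI)
      fix t
      show "\<bar>coord (z (r i) - z (r (Suc i))) t\<bar> \<le> \<epsilon>"
      proof (cases "t < R")
        case True
        with N'[of i t] N'[of "Suc i" t] i show ?thesis
          unfolding coord_simps dist_real_def by linarith
      next
        case False
        with R[of t] flat[of "r i" t] flat[of "r (Suc i)" t] show ?thesis by simp
      qed
    qed
  qed
qed

text \<open>
  A gliding hump. Each new difference has so small a sup norm that its \<open>\<ell>\<^sub>1\<close> mass on the
  region \<open>{..<M i}\<close> occupied by its predecessors is at most \<open>\<eta>\<close>.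
\<close>
lemma exists_almost_disjoint_differences:
  fixes z :: "nat \<Rightarrow> c00"
  assumes flat: "\<And>i t. \<bar>coord (z i) t\<bar> \<le> \<theta> t" and \<theta>: "\<theta> \<longlonglongrightarrow> 0" and \<eta>: "0 < \<eta>"
  obtains p q M :: "nat \<Rightarrow> nat" where "strict_mono p" "strict_mono q" "mono M"
    "\<And>i. p i < q i" "\<And>i. supp (z (p i) - z (q i)) \<subseteq> {..<M (Suc i)}"
    "\<And>i. sup_norm (z (p i) - z (q i)) \<le> \<eta>" "\<And>i. real (M i) * sup_norm (z (p i) - z (q i)) \<le> \<eta>"
proof -
  \<comment> \<open>A state of the construction: a pair of indices and the bounds of the occupied region before and after it.\<close>
  define P where "P = (\<lambda>(p, q, M, M'). p < q \<and> M \<le> M' \<and> supp (z p - z q) \<subseteq> {..<M'} \<and>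
    sup_norm (z p - z q) \<le> \<eta> \<and> real M * sup_norm (z p - z q) \<le> \<eta>)"
  define Q where "Q = (\<lambda>(p::nat, q::nat, M::nat, M'::nat) (p'::nat, q'::nat, N::nat, N'::nat). q < p' \<and> N = M')"
  have step: "\<exists>p q M'. N \<le> p \<and> P (p, q, M, M')" for N M
  proof -
    obtain p q where pq: "N \<le> p" "p < q" "sup_norm (z p - z q) \<le> \<eta> / real (Suc M)"
      using exists_small_difference[of z \<theta> "\<eta> / real (Suc M)" N, OF flat \<theta>] \<eta> by auto
    have le: "real (Suc M) * sup_norm (z p - z q) \<le> \<eta>" using pq(3) by (simp add: field_simps)
    have "0 \<le> real M * sup_norm (z p - z q)" by (simp add: sup_norm_nonneg)
    moreover have "real (Suc M) * sup_norm (z p - z q) = sup_norm (z p - z q) + real M * sup_norm (z p - z q)"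
      by (simp add: distrib_right)
    ultimately have "sup_norm (z p - z q) \<le> \<eta>" "real M * sup_norm (z p - z q) \<le> \<eta>"
      using le sup_norm_nonneg[of "z p - z q"] by linarith+
    moreover have "supp (z p - z q) \<subseteq> {..<max M (Suc (Max (supp (z p - z q))))}"
      by (auto simp: less_max_iff_disj less_Suc_eq_le)
    ultimately show ?thesis using pq unfolding P_def
      by (intro exI[of _ p] exI[of _ q] exI[of _ "max M (Suc (Max (supp (z p - z q))))"]) auto
  qed
  have "\<exists>f. \<forall>n. P (f n) \<and> Q (f n) (f (Suc n))"
  proof (rule dependent_nat_choice[of "\<lambda>_. P" "\<lambda>_. Q"])
    show "\<exists>s. P s" using step by blast
    fix s assume "P s"
    obtain p q M M' where "s = (p, q, M, M')" by (cases s) auto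
    then show "\<exists>s'. P s' \<and> Q s s'" using step[of "Suc q" M'] by (auto simp: Q_def Suc_le_eq)
  qed
  then obtain f where f: "\<And>n. P (f n)" "\<And>n. Q (f n) (f (Suc n))" by blast
  define p q M M' where "p n = fst (f n)" and "q n = fst (snd (f n))"
    and "M n = fst (snd (snd (f n)))" and "M' n = snd (snd (snd (f n)))" for n
  have feq: "f n = (p n, q n, M n, M' n)" for n by (simp add: p_def q_def M_def M'_def)
  have Pn: "p n < q n" "M n \<le> M' n" "supp (z (p n) - z (q n)) \<subseteq> {..<M' n}"
    "sup_norm (z (p n) - z (q n)) \<le> \<eta>" "real (M n) * sup_norm (z (p n) - z (q n)) \<le> \<eta>" for n
    using f(1)[of n] unfolding feq P_def by auto
  have Qn: "q n < p (Suc n)" "M (Suc n) = M' n" for n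
    using f(2)[of n] unfolding feq Q_def by auto
  show thesis
  proof (rule that[of p q M])
    show "strict_mono p" unfolding strict_mono_Suc_iff
    proof
      show "p n < p (Suc n)" for n using Pn(1)[of n] Pn(1)[of "Suc n"] Qn(1)[of n] by linarith
    qed
    show "strict_mono q" unfolding strict_mono_Suc_iff
    proof
      show "q n < q (Suc n)" for n using Pn(1)[of n] Pn(1)[of "Suc n"] Qn(1)[of n] by linarith
    qed
    show "mono M" unfolding mono_iff_le_Suc using Pn(2) Qn(2) by simp
    fix i
    show "p i < q i" by (rule Pn(1))
    show "supp (z (p i) - z (q i)) \<subseteq> {..<M (Suc i)}" unfolding Qn(2) by (rule Pn(3))
    show "sup_norm (z (p i) - z (q i)) \<le> \<eta>" by (rule Pn(4))
    show "real (M i) * sup_norm (z (p i) - z (q i)) \<le> \<eta>" by (rule Pn(5))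
  qed
qed

section \<open>A copy of the space cannot consist of flat vectors\<close>

lemma norm_spread_unit_vec_le:
  assumes p: "strict_mono p"
  shows "norm (\<Sum>i<m. a i *\<^sub>R unit_vec (p i)) \<le> norm (fin_vec a {..<m})"
proof (rule norm_c00_spread[OF p])
  have coord: "coord (\<Sum>i<m. a i *\<^sub>R unit_vec (p i)) t = (\<Sum>i<m. if t = p i then a i else 0)" for t
    by (auto simp: coord_sum coord_unit_vec intro!: sum.cong)
  show "\<bar>coord (\<Sum>i<m. a i *\<^sub>R unit_vec (p i)) (p j)\<bar> \<le> \<bar>coord (fin_vec a {..<m}) j\<bar>" for j
    unfolding coord by (simp add: strict_mono_eq[OF p] coord_fin_vec)
  show "supp (\<Sum>i<m. a i *\<^sub>R unit_vec (p i)) \<subseteq> range p"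
  proof
    fix t assume "t \<in> supp (\<Sum>i<m. a i *\<^sub>R unit_vec (p i))"
    then have "(\<Sum>i<m. if t = p i then a i else 0) \<noteq> 0" by (simp add: supp_def coord)
    then show "t \<in> range p" by (rule contrapos_np) (auto intro!: sum.neutral)
  qed
qed

lemma ruler_Suc_ge_1: "1 \<le> ruler (Suc K) t"
proof -
  have "(if 4 ^ 0 dvd t then 2 ^ 0 else 0 :: real) \<le> ruler (Suc K) t"
    unfolding ruler_def by (rule member_le_sum) auto
  then show ?thesis by simp
qed

text \<open>
  Combine nearly disjoint differences \<open>d i\<close> of the \<open>z i\<close> with the ruler coefficients on \<open>{..<4\<^sup>K}\<close>.
  By \<open>upper\<close> and subsymmetry the norm is at most a constant times \<open>2\<^sup>K\<close>. The
  lower estimate for flat blocks makes it at least a constant times \<open>\<surd>(K + 1) 2\<^sup>K\<close>, which is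
  impossible for large \<open>K\<close>.
\<close>
lemma no_flat_copy_of_basis:
  fixes z :: "nat \<Rightarrow> c00"
  assumes flat: "\<And>i t. \<bar>coord (z i) t\<bar> \<le> \<theta> t" and \<theta>: "\<theta> \<longlonglongrightarrow> 0"
    and upper: "\<And>(a :: nat \<Rightarrow> real) (p :: nat \<Rightarrow> nat) (m :: nat). strict_mono p \<Longrightarrow>
      norm (\<Sum>i<m. a i *\<^sub>R z (p i)) \<le> B * norm (\<Sum>i<m. a i *\<^sub>R unit_vec (p i))"
    and B: "0 \<le> B" and sep: "\<And>i j. i < j \<Longrightarrow> b \<le> norm (z i - z j)" and b: "0 < b"
  shows False
proof -
  have bound: "(b / 2)\<^sup>2 * real (Suc K) \<le> 128 * (12 * B + 1)\<^sup>2" for K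
  proof -
    define m where "m = (4::nat) ^ K"
    define a where "a = ruler (Suc K)"
    have a1: "1 \<le> a i" and a2: "a i \<le> 2 * 2 ^ K" for i
      using ruler_Suc_ge_1 ruler_le[of "Suc K" i] by (simp_all add: a_def)
    \<comment> \<open>In turn, these bounds keep the blocks large, their multiples flat, and the total error below \<open>2 ^ K\<close>.\<close>
    define \<eta> where "\<eta> = Min {b / 2, b / (12 * 2 ^ K), 1 / (2 * 4 ^ K)}"
    have \<eta>: "0 < \<eta>" "\<eta> \<le> b / 2" "\<eta> \<le> b / (12 * 2 ^ K)" "\<eta> \<le> 1 / (2 * 4 ^ K)"
      using b by (simp_all add: \<eta>_def)
    obtain p q M :: "nat \<Rightarrow> nat" where pq: "strict_mono p" "strict_mono q" "\<And>i. p i < q i"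
      and M: "mono M" "\<And>i. supp (z (p i) - z (q i)) \<subseteq> {..<M (Suc i)}"
      and small: "\<And>i. sup_norm (z (p i) - z (q i)) \<le> \<eta>"
        "\<And>i. real (M i) * sup_norm (z (p i) - z (q i)) \<le> \<eta>"
      by (rule exists_almost_disjoint_differences[of z \<theta> \<eta>, OF flat \<theta> \<eta>(1)]) blast
    define d where "d i = z (p i) - z (q i)" for i
    \<comment> \<open>Removing the small head of \<open>d i\<close> makes the supports successive.\<close>
    define g where "g i = restrict_c00 {M i..} (d i)" for i
    have dg: "norm (d i - g i) \<le> \<eta>" for i
    proof -
      have "supp (d i - g i) \<subseteq> {..<M i}" by (auto simp: supp_def g_def)
      then have "norm (d i - g i) \<le> (\<Sum>t<M i. \<bar>coord (d i - g i) t\<bar>)"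
        by (intro norm_le_sum_abs_coord) auto
      also have "\<dots> \<le> (\<Sum>t<M i. sup_norm (d i))"
        using coord_le_sup_norm[of "d i"] by (intro sum_mono) (simp add: g_def)
      also have "\<dots> \<le> \<eta>" using small(2)[of i] by (simp add: d_def)
      finally show ?thesis .
    qed
    have g_ge: "b / 2 \<le> norm (g i)" for i
    proof -
      have "b \<le> norm (d i)" unfolding d_def by (rule sep[OF pq(3)])
      moreover have "norm (d i) \<le> norm (d i - g i) + norm (g i)"
        using norm_triangle_ineq[of "d i - g i" "g i"] by simp
      ultimately show ?thesis using dg[of i] \<eta>(2) by linarith
    qed
    have lower: "(\<Sum>i<m. (norm (a i *\<^sub>R g i))\<^sup>2) \<le> 128 * (norm (\<Sum>i<m. a i *\<^sub>R g i))\<^sup>2"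
    proof (rule flat_blocks_lower_l2[OF M(1)])
      show "supp (a i *\<^sub>R g i) \<subseteq> {M i..<M (Suc i)}" for i
        using M(2)[of i] by (auto simp: g_def d_def supp_def)
      show "0 < b / 6" using b by simp
      show "sup_norm (a i *\<^sub>R g i) \<le> b / 6" for i
      proof (rule sup_norm_leI)
        fix t
        have "\<bar>coord (g i) t\<bar> \<le> \<eta>"
          using coord_le_sup_norm[of "d i" t] small(1)[of i] \<eta>(1) by (simp add: g_def d_def)
        then have "a i * \<bar>coord (g i) t\<bar> \<le> (2 * 2 ^ K) * (b / (12 * 2 ^ K))"
          using a1[of i] a2[of i] \<eta>(3) by (intro mult_mono) auto
        also have "\<dots> = b / 6" by simp
        finally show "\<bar>coord (a i *\<^sub>R g i) t\<bar> \<le> b / 6" using a1[of i] by (simp add: abs_mult)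
      qed
      show "8 * (b / 6)\<^sup>2 \<le> (norm (a i *\<^sub>R g i))\<^sup>2" for i
      proof -
        have "1 * (b / 2) \<le> a i * norm (g i)" using a1[of i] g_ge[of i] b by (intro mult_mono) auto
        then have "(b / 2)\<^sup>2 \<le> (norm (a i *\<^sub>R g i))\<^sup>2" using a1[of i] b by (intro power_mono) auto
        moreover have "8 * (b / 6)\<^sup>2 \<le> (b / 2)\<^sup>2" by (simp add: power_divide)
        ultimately show ?thesis by linarith
      qed
    qed
    have "norm (\<Sum>i<m. a i *\<^sub>R z (r i)) \<le> B * (6 * 2 ^ K)" if "strict_mono r" for r :: "nat \<Rightarrow> nat"
    proof -
      have "norm (\<Sum>i<m. a i *\<^sub>R unit_vec (r i)) \<le> 6 * 2 ^ K"
        using norm_spread_unit_vec_le[OF that, of a m] norm_ruler_initial_le[of K]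
        unfolding m_def a_def by linarith
      then show ?thesis using upper[OF that, of a m] B by (meson mult_left_mono order_trans)
    qed
    from this[OF pq(1)] this[OF pq(2)] have "norm (\<Sum>i<m. a i *\<^sub>R d i) \<le> 12 * B * 2 ^ K"
      unfolding d_def scaleR_diff_right sum_subtractf
      using norm_triangle_ineq4[of "\<Sum>i<m. a i *\<^sub>R z (p i)" "\<Sum>i<m. a i *\<^sub>R z (q i)"] by linarith
    moreover have "norm (\<Sum>i<m. a i *\<^sub>R (d i - g i)) \<le> 2 ^ K"
    proof -
      have "norm (\<Sum>i<m. a i *\<^sub>R (d i - g i)) \<le> (\<Sum>i<m. (2 * 2 ^ K) * (1 / (2 * 4 ^ K)))"
      proof (rule sum_norm_le)
        fix i
        have "a i * norm (d i - g i) \<le> (2 * 2 ^ K) * (1 / (2 * 4 ^ K))"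
          using a1[of i] a2[of i] dg[of i] \<eta>(4) by (intro mult_mono) auto
        then show "norm (a i *\<^sub>R (d i - g i)) \<le> (2 * 2 ^ K) * (1 / (2 * 4 ^ K))"
          using a1[of i] by simp
      qed
      then show ?thesis by (simp add: m_def)
    qed
    moreover have "(\<Sum>i<m. a i *\<^sub>R g i) = (\<Sum>i<m. a i *\<^sub>R d i) - (\<Sum>i<m. a i *\<^sub>R (d i - g i))"
      by (simp add: scaleR_diff_right sum_subtractf)
    ultimately have "norm (\<Sum>i<m. a i *\<^sub>R g i) \<le> (12 * B + 1) * 2 ^ K"
      using norm_triangle_ineq4[of "\<Sum>i<m. a i *\<^sub>R d i" "\<Sum>i<m. a i *\<^sub>R (d i - g i)"]
      by (simp add: distrib_right)
    then have "(norm (\<Sum>i<m. a i *\<^sub>R g i))\<^sup>2 \<le> ((12 * B + 1) * 2 ^ K)\<^sup>2" by (intro power_mono) auto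
    also have "\<dots> = (12 * B + 1)\<^sup>2 * 4 ^ K"
      by (simp add: power_mult_distrib power2_eq_square[of "2 ^ K"] power_mult_distrib[symmetric])
    finally have up: "(norm (\<Sum>i<m. a i *\<^sub>R g i))\<^sup>2 \<le> (12 * B + 1)\<^sup>2 * 4 ^ K" .
    have "(b / 2)\<^sup>2 * (real (Suc K) * 4 ^ K) \<le> (b / 2)\<^sup>2 * (\<Sum>i<m. (a i)\<^sup>2)"
      unfolding a_def m_def by (intro mult_left_mono ruler_sum_squares_ge) simp
    also have "\<dots> = (\<Sum>i<m. (a i * (b / 2))\<^sup>2)" by (simp only: sum_distrib_left power_mult_distrib mult.commute)
    also have "\<dots> \<le> (\<Sum>i<m. (norm (a i *\<^sub>R g i))\<^sup>2)"
    proof (rule sum_mono)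
      fix i
      have "a i * (b / 2) \<le> a i * norm (g i)" using a1[of i] g_ge[of i] by (intro mult_left_mono) auto
      then show "(a i * (b / 2))\<^sup>2 \<le> (norm (a i *\<^sub>R g i))\<^sup>2"
        using a1[of i] b by (intro power_mono) auto
    qed
    finally have "(b / 2)\<^sup>2 * (real (Suc K) * 4 ^ K) \<le> 128 * ((12 * B + 1)\<^sup>2 * 4 ^ K)"
      using lower up by linarith
    then have "((b / 2)\<^sup>2 * real (Suc K)) * 4 ^ K \<le> (128 * (12 * B + 1)\<^sup>2) * 4 ^ K"
      by (simp only: mult.assoc)
    then show ?thesis by (rule mult_right_le_imp_le) simp
  qed
  obtain K where "128 * (12 * B + 1)\<^sup>2 / (b / 2)\<^sup>2 < real K" using reals_Archimedean2 by blast
  then have "128 * (12 * B + 1)\<^sup>2 < (b / 2)\<^sup>2 * real K" using b by (simp add: divide_less_eq mult.commute)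
  also have "\<dots> \<le> (b / 2)\<^sup>2 * real (Suc K)" by (intro mult_left_mono) auto
  finally show False using bound[of K] by linarith
qed

text \<open>
  Meant for an embedding and for its inverse. The inverse is homogeneous on the range \<open>V\<close> of the
  embedding, while its values elsewhere are arbitrary.
\<close>
lemma homogeneous_continuous_bounded:
  fixes f :: "'a::real_normed_vector \<Rightarrow> 'b::real_normed_vector"
  assumes V: "subspace V" and cont: "continuous_on V f"
    and hom: "\<And>c x. x \<in> V \<Longrightarrow> f (c *\<^sub>R x) = c *\<^sub>R f x"
  obtains B where "0 < B" "\<And>x. x \<in> V \<Longrightarrow> norm (f x) \<le> B * norm x"
proof -
  have V0: "0 \<in> V" and f0: "f 0 = 0" using V hom[of 0 0] by (auto simp: subspace_0)
  obtain e where e: "0 < e" "\<And>x. x \<in> V \<Longrightarrow> norm x < e \<Longrightarrow> norm (f x) < 1"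
    using cont[unfolded continuous_on_iff, rule_format, OF V0, of 1] by (auto simp: f0)
  have "norm (f x) \<le> 2 / e * norm x" if x: "x \<in> V" for x
  proof (cases "x = 0")
    case False
    define c where "c = e / (2 * norm x)"
    have c: "0 < c" using e(1) False by (simp add: c_def)
    have "norm (c *\<^sub>R x) < e" using False e(1) by (simp add: c_def)
    then have "c * norm (f x) < 1"
      using e(2)[of "c *\<^sub>R x"] hom[OF x, of c] V x c by (simp add: subspace_scale)
    then have "norm (f x) < 1 / c" using c by (simp add: field_simps)
    also have "1 / c = 2 / e * norm x" using False e(1) by (simp add: c_def)
    finally show ?thesis by simp
  qed (simp add: f0)
  then show thesis using that[of "2 / e"] e(1) by simp
qed

lemma subspace_closure_of_subspace:
  fixes V :: "'a::real_normed_vector set"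
  assumes V: "subspace V"
  shows "subspace (closure V)"
proof (rule subspaceI)
  show "0 \<in> closure V" using V closure_subset by (blast dest: subspace_0)
next
  fix x y assume "x \<in> closure V" "y \<in> closure V"
  then obtain f g where "\<And>n. f n \<in> V" "f \<longlonglongrightarrow> x" "\<And>n. g n \<in> V" "g \<longlonglongrightarrow> y"
    unfolding closure_sequential by blast
  then show "x + y \<in> closure V"
    unfolding closure_sequential using V
    by (intro exI[of _ "\<lambda>n. f n + g n"]) (auto intro: subspace_add tendsto_add)
next
  fix x and c :: real assume "x \<in> closure V"
  then obtain f where "\<And>n. f n \<in> V" "f \<longlonglongrightarrow> x"
    unfolding closure_sequential by blast
  then show "c *\<^sub>R x \<in> closure V"
    unfolding closure_sequential using V
    by (intro exI[of _ "\<lambda>n. c *\<^sub>R f n"]) (auto intro: subspace_scale tendsto_scaleR)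
qed

theorem corollary3p9:
  shows "\<not> minimal_space (UNIV :: ti_space set)"
proof
  assume min: "minimal_space (UNIV :: ti_space set)"
  define Z :: "ti_space set" where "Z = closure (completion_embed ` range stretch)"
  have "subspace (completion_embed ` range stretch :: ti_space set)"
    by (intro linear_subspace_image linear_completion_embed linear_stretch subspace_UNIV)
  then have "subspace Z" unfolding Z_def by (rule subspace_closure_of_subspace)
  moreover have "closed Z" by (simp add: Z_def)
  moreover have "infinite_dimensional Z" unfolding Z_def by (rule infinite_dimensional_closure_stretch)
  ultimately obtain W where W: "W \<subseteq> Z" "subspace W" "linearly_homeomorphic (UNIV :: ti_space set) W"
    using min unfolding minimal_space_def by blast
  then obtain T S where T: "linear T" and hom: "homeomorphism (UNIV :: ti_space set) W T S"
    unfolding linearly_homeomorphic_def by blast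
  obtain B where B: "0 < B" "\<And>x. norm (T x) \<le> B * norm x"
    using homogeneous_continuous_bounded[of UNIV T] hom T
    by (auto simp: homeomorphism_def linear_scale)
  obtain C where C: "0 < C" "\<And>w. w \<in> W \<Longrightarrow> norm (S w) \<le> C * norm w"
  proof (rule homogeneous_continuous_bounded[of W S])
    show "continuous_on W S" using hom by (simp add: homeomorphism_def)
    fix c w assume "w \<in> W"
    then show "S (c *\<^sub>R w) = c *\<^sub>R S w"
      using hom by (auto simp: homeomorphism_def linear_scale[OF T, symmetric])
  qed (use W in auto)
  have lowerT: "norm x \<le> C * norm (T x)" for x
  proof -
    have "T x \<in> W" "S (T x) = x" using hom by (auto simp: homeomorphism_def)
    with C(2)[of "T x"] show ?thesis by simp
  qed
  define e where "e i = (completion_embed (unit_vec i) :: ti_space)" for i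
  \<comment> \<open>Half of the lower bound \<open>1 / C\<close> for \<open>T\<close> is given up when \<open>T (e i)\<close> is replaced by a finite sequence.\<close>
  define \<epsilon> where "\<epsilon> = 1 / (2 * C)"
  have \<epsilon>: "0 < \<epsilon>" using C(1) by (simp add: \<epsilon>_def)
  have "\<exists>x. dist (completion_embed (stretch x)) (T (e i)) < \<epsilon> * (1/2) ^ Suc i" for i
  proof -
    have "T (e i) \<in> closure (completion_embed ` range stretch)"
      using hom W(1) by (auto simp: homeomorphism_def Z_def)
    moreover have "0 < \<epsilon> * (1/2) ^ Suc i" using \<epsilon> by simp
    ultimately show ?thesis unfolding closure_approachable by blast
  qed
  then obtain y where y: "\<And>i. dist (completion_embed (stretch (y i))) (T (e i)) < \<epsilon> * (1/2) ^ Suc i"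
    by metis
  define z where "z i = stretch (y i)" for i
  have near: "norm (completion_embed (z i) - T (e i)) \<le> \<epsilon> * (1/2) ^ Suc i" for i
    using y[of i] by (simp add: z_def dist_norm)
  have norm_e: "norm (e i) = 1" for i by (simp add: e_def norm_unit_vec)
  have half: "\<epsilon> * (1/2) ^ Suc i \<le> \<epsilon> / 2" for i
    using \<epsilon> power_le_one[of "1/2::real" i] by simp
  have norm_z: "norm (z i) \<le> B + \<epsilon>" for i
  proof -
    have "norm (z i) = norm (completion_embed (z i))" by simp
    also have "\<dots> \<le> norm (completion_embed (z i) - T (e i)) + norm (T (e i))"
      using norm_triangle_ineq[of "completion_embed (z i) - T (e i)" "T (e i)"] by simp
    also have "\<dots> \<le> \<epsilon> + B" using near[of i] half[of i] \<epsilon> B(2)[of "e i"]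
      unfolding norm_e mult_1_right by linarith
    finally show ?thesis by simp
  qed
  show False
  proof (rule no_flat_copy_of_basis)
    show "\<bar>coord (z i) t\<bar> \<le> 2 / sqrt (real (2 * floor_sqrt t + 1)) * (B + \<epsilon>)" for i t
    proof -
      have "2 / sqrt (real (2 * floor_sqrt t + 1)) * norm (z i)
          \<le> 2 / sqrt (real (2 * floor_sqrt t + 1)) * (B + \<epsilon>)"
        using norm_z[of i] by (intro mult_left_mono) auto
      with abs_coord_stretch_le[of "y i" t] show ?thesis unfolding z_def by linarith
    qed
    have "filterlim floor_sqrt at_top sequentially"
      unfolding filterlim_at_top eventually_sequentially by (meson le_floor_sqrtI order_refl)
    then have "(\<lambda>t. 2 / sqrt (real (2 * floor_sqrt t + 1))) \<longlonglongrightarrow> 0"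
    proof (rule filterlim_compose[rotated])
      show "(\<lambda>k. 2 / sqrt (real (2 * k + 1))) \<longlonglongrightarrow> 0" by real_asymp
    qed
    from tendsto_mult_left_zero[OF this]
    show "(\<lambda>t. 2 / sqrt (real (2 * floor_sqrt t + 1)) * (B + \<epsilon>)) \<longlonglongrightarrow> 0" .
    show "norm (\<Sum>i<m. a i *\<^sub>R z (p i)) \<le> (B + \<epsilon>) * norm (\<Sum>i<m. a i *\<^sub>R unit_vec (p i))"
      if p: "strict_mono p" for a :: "nat \<Rightarrow> real" and p :: "nat \<Rightarrow> nat" and m :: nat
    proof -
      define u where "u = (\<Sum>i<m. a i *\<^sub>R unit_vec (p i))"
      have embed: "completion_embed (\<Sum>i<m. a i *\<^sub>R x i) = (\<Sum>i<m. a i *\<^sub>R completion_embed (x i))"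
        for x :: "nat \<Rightarrow> c00"
        by (simp add: linear_sum[OF linear_completion_embed] linear_scale[OF linear_completion_embed])
      have Tu: "T (completion_embed u) = (\<Sum>i<m. a i *\<^sub>R T (e (p i)))"
        unfolding u_def embed by (simp add: linear_sum[OF T] linear_scale[OF T] e_def)
      have a_le: "\<bar>a i\<bar> \<le> norm u" if "i < m" for i
      proof -
        have "coord u (p i) = a i"
          using that by (simp add: u_def coord_sum coord_unit_vec strict_mono_eq[OF p] if_distrib
              cong: if_cong)
        then show ?thesis using abs_coord_le_norm[of u "p i"] by simp
      qed
      have "norm (\<Sum>i<m. a i *\<^sub>R (completion_embed (z (p i)) - T (e (p i)))) \<le> (\<Sum>i<m. (norm u * \<epsilon>) * (1/2) ^ Suc i)"
      proof (rule sum_norm_le)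
        fix i assume "i \<in> {..<m}"
        then have "\<bar>a i\<bar> * norm (completion_embed (z (p i)) - T (e (p i))) \<le> norm u * (\<epsilon> * (1/2) ^ Suc (p i))"
          using near a_le by (intro mult_mono) auto
        also have "\<dots> \<le> norm u * (\<epsilon> * (1/2) ^ Suc i)"
          using \<epsilon> seq_suble[OF p, of i] by (intro mult_left_mono power_decreasing) auto
        finally show "norm (a i *\<^sub>R (completion_embed (z (p i)) - T (e (p i)))) \<le> (norm u * \<epsilon>) * (1/2) ^ Suc i"
          by (simp add: mult.assoc)
      qed
      also have "\<dots> = (norm u * \<epsilon>) * (\<Sum>i<m. (1/2) ^ Suc i)" by (simp only: sum_distrib_left)
      also have "\<dots> \<le> (norm u * \<epsilon>) * 1"
      proof (rule mult_left_mono)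
        have "(\<Sum>i<m. (1/2) ^ Suc i) = 1 - (1/2::real) ^ m" by (induction m) auto
        then show "(\<Sum>i<m. (1/2) ^ Suc i) \<le> (1::real)" by simp
      qed (use \<epsilon> in simp)
      finally have err: "norm (\<Sum>i<m. a i *\<^sub>R (completion_embed (z (p i)) - T (e (p i)))) \<le> \<epsilon> * norm u"
        by (simp add: mult.commute)
      have "norm (\<Sum>i<m. a i *\<^sub>R z (p i)) = norm (completion_embed (\<Sum>i<m. a i *\<^sub>R z (p i)))" by simp
      also have "completion_embed (\<Sum>i<m. a i *\<^sub>R z (p i))
          = T (completion_embed u) + (\<Sum>i<m. a i *\<^sub>R (completion_embed (z (p i)) - T (e (p i))))"
        unfolding Tu embed by (simp add: scaleR_diff_right sum_subtractf)
      also have "norm \<dots> \<le> B * norm u + \<epsilon> * norm u"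
        using B(2)[of "completion_embed u"] err
        by (intro norm_triangle_le add_mono) (simp_all only: norm_completion_embed)
      finally show ?thesis by (simp add: u_def distrib_right)
    qed
    show "1 / C - \<epsilon> \<le> norm (z i - z j)" if "i < j" for i j
    proof -
      have "1 \<le> norm (unit_vec i - unit_vec j)"
        using abs_coord_le_norm[of "unit_vec i - unit_vec j" i] that by (simp add: coord_unit_vec)
      also have "\<dots> = norm (e i - e j)" by (simp add: e_def completion_embed_diff[symmetric])
      also have "\<dots> \<le> C * norm (T (e i) - T (e j))"
        using lowerT[of "e i - e j"] by (simp add: linear_diff[OF T])
      finally have 1: "1 / C \<le> norm (T (e i) - T (e j))" using C(1) by (simp add: field_simps)
      have "T (e i) - T (e j) = (completion_embed (z i) - completion_embed (z j))
          - ((completion_embed (z i) - T (e i)) - (completion_embed (z j) - T (e j)))" by simp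
      then have "norm (T (e i) - T (e j)) \<le> norm (completion_embed (z i) - completion_embed (z j))
          + (norm (completion_embed (z i) - T (e i)) + norm (completion_embed (z j) - T (e j)))"
        by (metis (no_types, lifting) norm_triangle_ineq4 add_left_mono order_trans)
      moreover have "norm (completion_embed (z i) - completion_embed (z j)) = norm (z i - z j)"
        by (simp add: completion_embed_diff[symmetric])
      ultimately show ?thesis using 1 near[of i] near[of j] half[of i] half[of j] by linarith
    qed
    show "0 \<le> B + \<epsilon>" "0 < 1 / C - \<epsilon>" using B(1) C(1) \<epsilon> by (simp_all add: \<epsilon>_def field_simps)
  qed
qed

end
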